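(* Let $\mathbb{F}$ be an algebraically closed field and let $n\ge 3$. The following are equivalent for a non-scalar matrix $A\in M_n(\mathbb{F})$. (i) $A$ is minimal. (ii) There exists a non-scalar matrix $X\in M_n(\mathbb{F})$ such that $d(A,X)=4$.
   Context: For $A\in M_n(\mathbb{F})$, $\mathcal{C}(A)=\{X\in M_n(\mathbb{F}): AX=XA\}$. A matrix $A$ is minimal if $\mathcal{C}(X)\subseteq\mathcal{C}(A)$ implies $\mathcal{C}(X)=\mathcal{C}(A)$ for every $X\in M_n(\mathbb{F})$ (equivalently, $A$ is nonderogatory: every eigenvalue has geometric multiplicity one). The commuting graph $\Gamma(M_n(\mathbb{F}))$ is the simple graph whose vertices are all non-scalar matrices in $M_n(\mathbb{F})$; two vertices $X\ne Y$ are joined by an edge iff $XY=YX$. $d(X,Y)$ is the length of a shortest path between vertices $X$ and $Y$ in this graph. *)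

theory Defs
  imports
    "HOL-Library.Extended_Nat"
    "HOL-Computational_Algebra.Polynomial"
    "Jordan_Normal_Form.Matrix"
    "Graph_Theory.Pair_Digraph"
begin

definition scalar_mat :: "nat \<Rightarrow> 'a::field mat \<Rightarrow> bool" where
  "scalar_mat n A \<longleftrightarrow> (\<exists>c. A = c \<cdot>\<^sub>m 1\<^sub>m n)"

definition centralizer :: "nat \<Rightarrow> 'a::field mat \<Rightarrow> 'a mat set" where
  "centralizer n A = {X \<in> carrier_mat n n. A * X = X * A}"

definition minimal_mat :: "nat \<Rightarrow> 'a::field mat \<Rightarrow> bool" where
  "minimal_mat n A \<longleftrightarrow>
     (\<forall>X \<in> carrier_mat n n. centralizer n X \<subseteq> centralizer n A \<longrightarrow> centralizer n X = centralizer n A)"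

text \<open>As usual in \<^theory>\<open>Graph_Theory.Pair_Digraph\<close>, a simple graph is a symmetric loop-free digraph
  whose arcs are ordered pairs of vertices.\<close>

definition commuting_graph :: "nat \<Rightarrow> 'a::field mat pair_pre_digraph" where
  "commuting_graph n =
     \<lparr> pverts = {X \<in> carrier_mat n n. \<not> scalar_mat n X},
       parcs = {(X, Y). X \<in> carrier_mat n n \<and> \<not> scalar_mat n X \<and>
                        Y \<in> carrier_mat n n \<and> \<not> scalar_mat n Y \<and>
                        X \<noteq> Y \<and> X * Y = Y * X} \<rparr>"

lemma pair_loopfree_digraph_commuting_graph: "pair_loopfree_digraph (commuting_graph n)"
  by unfold_locales (auto simp: commuting_graph_def)

lemma pair_sym_digraph_commuting_graph: "pair_sym_digraph (commuting_graph n)"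
  by unfold_locales (auto simp: commuting_graph_def symmetric_def sym_def arcs_ends_def arc_to_ends_def)

text \<open>A path is given by its list of arcs, so \<^const>\<open>length\<close> is the number of edges; the infimum over the
  empty set makes the distance \<open>\<infinity>\<close> if no path exists.\<close>

definition graph_dist :: "('v, 'e) pre_digraph \<Rightarrow> 'v \<Rightarrow> 'v \<Rightarrow> enat" where
  "graph_dist G u v = (INF p \<in> {p. pre_digraph.apath G u p v}. enat (length p))"

end

theory Submission
  imports Defs "Jordan_Normal_Form.Jordan_Normal_Form_Existence"
begin

text \<open>Every matrix over an algebraically closed field commutes with a matrix \<open>u w\<close> of rank one, \<open>u\<close> and \<open>w\<close>
  being a right and a left eigenvector for the same eigenvalue. Two such matrices have a common
  neighbour of rank one if \<open>n \<ge> 3\<close>, so all distances are at most 4. If \<open>A\<close> is derogatory, then \<open>u\<close> and \<open>w\<close>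
  can be chosen in two-dimensional spaces, which leaves enough freedom to make \<open>u w\<close> commute with a
  given matrix of rank one, so that \<open>d(A, X) \<le> 3\<close> for all \<open>X\<close>. If \<open>A\<close> is nonderogatory, it is a companion
  matrix in a suitable basis; with \<open>X\<close> the nilpotent upper shift in this basis, a non-scalar \<open>Z\<close> that
  commutes with \<open>X\<close> leaves some \<open>V = span(e_0, ..., e_(k-1))\<close> with \<open>0 < k < n\<close> as the kernel of \<open>Z - z\<close>, but
  no non-scalar polynomial in \<open>A\<close> maps \<open>V\<close> to itself, whence \<open>d(A, X) > 3\<close>. Finally, changing the
  eigenvalues of the Jordan blocks of \<open>A\<close> to distinct ones gives a nonderogatory \<open>B\<close> whose centralizer is
  contained in that of \<open>A\<close>; the two agree if \<open>A\<close> is minimal, and the condition \<open>d(A, X) > 3\<close> depends on \<open>A\<close> only through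
  its centralizer.\<close>

section \<open>Walks in the commuting graph\<close>

text \<open>Walks need no distinct vertices and a length bound is monotone, which yields a one-arc
  recursion; \<open>graph_dist_le_iff\<close> returns to shortest paths.\<close>

definition walk_le :: "nat \<Rightarrow> nat \<Rightarrow> 'a::field mat \<Rightarrow> 'a mat \<Rightarrow> bool" where
  "walk_le n k A X \<longleftrightarrow>
     (\<exists>p. pre_digraph.awalk (with_proj (commuting_graph n)) A p X \<and> length p \<le> k)"

definition nonscalar :: "nat \<Rightarrow> 'a::field mat set" where
  "nonscalar n = {X \<in> carrier_mat n n. \<not> scalar_mat n X}"

lemma pverts_commuting_graph [simp]: "pverts (commuting_graph n) = nonscalar n"
  by (auto simp: commuting_graph_def nonscalar_def)

lemma parcs_commuting_graph [simp]:
  "(X, Y) \<in> parcs (commuting_graph n) \<longleftrightarrow>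
     X \<in> nonscalar n \<and> Y \<in> nonscalar n \<and> X \<noteq> Y \<and> X * Y = Y * X"
  by (auto simp: commuting_graph_def nonscalar_def)

lemma walk_le_0: "walk_le n 0 A X \<longleftrightarrow> A = X \<and> A \<in> nonscalar n"
proof -
  interpret G: pair_loopfree_digraph "commuting_graph n"
    by (rule pair_loopfree_digraph_commuting_graph)
  show ?thesis
    by (auto simp: walk_le_def G.awalk_Nil_iff)
qed

lemma walk_le_Suc:
  "walk_le n (Suc k) A X \<longleftrightarrow>
     A \<in> nonscalar n \<and> (\<exists>Y \<in> nonscalar n. A * Y = Y * A \<and> walk_le n k Y X)"
  (is "?L \<longleftrightarrow> ?R")
proof -
  interpret G: pair_loopfree_digraph "commuting_graph n"
    by (rule pair_loopfree_digraph_commuting_graph)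
  show ?thesis
  proof
    assume ?L
    then obtain p where p: "G.awalk A p X" "length p \<le> Suc k" by (auto simp: walk_le_def)
    have A: "A \<in> nonscalar n"
      using G.awalk_hd_in_verts[OF p(1)] by simp
    show ?R
    proof (cases p)
      case Nil
      then have "walk_le n k A X" using p by (auto simp: walk_le_def intro!: exI[of _ "[]"])
      with A show ?thesis by blast
    next
      case (Cons e es)
      obtain U Y where e: "e = (U, Y)" by force
      have "(A, Y) \<in> parcs (commuting_graph n)" "walk_le n k Y X"
        using p Cons e by (auto simp: walk_le_def G.awalk_Cons_iff)
      then show ?thesis by auto
    qed
  next
    assume ?R
    then obtain Y p where Y: "A \<in> nonscalar n" "Y \<in> nonscalar n" "A * Y = Y * A"
      and p: "G.awalk Y p X" "length p \<le> k" by (auto simp: walk_le_def)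
    show ?L
    proof (cases "A = Y")
      case True
      then show ?thesis using p by (auto simp: walk_le_def intro!: exI[of _ p])
    next
      case False
      with Y p show ?thesis
        by (auto simp: walk_le_def G.awalk_Cons_iff
            intro!: exI[of _ "(A, Y) # p"])
    qed
  qed
qed

text \<open>Each step of the construction cuts out a cycle, so the length can only drop.\<close>

lemma (in wf_digraph) length_awalk_to_apath:
  assumes "awalk u p v"
  shows "length (awalk_to_apath p) \<le> length p"
  using assms
proof (induct rule: awalk_to_apath_induct)
  case (path p)
  then have "awalk_to_apath p = p" by (auto simp: awalk_to_apath.simps)
  then show ?case by simp
next
  case (decomp p q r s)
  then have "awalk_to_apath p = awalk_to_apath (q @ s)"
    using step_awalk_to_apath[of _ p _ q r s] by simp
  moreover have "p = q @ r @ s"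
    using awalk_cyc_decomp_has_prop[OF decomp(1) decomp(3)] decomp(2) by auto
  ultimately show ?case using decomp by simp
qed

text \<open>The infimum over a nonempty set is attained because \<open>enat\<close> is well-ordered;
  conversely, removing the cycles of a walk gives a path that is no longer.\<close>

lemma graph_dist_le_iff:
  "graph_dist (with_proj (commuting_graph n)) A X \<le> enat k \<longleftrightarrow> walk_le n k A X"
  (is "?d \<le> _ \<longleftrightarrow> _")
proof -
  interpret G: pair_loopfree_digraph "commuting_graph n"
    by (rule pair_loopfree_digraph_commuting_graph)
  let ?S = "{p. G.apath A p X}"
  show ?thesis
  proof
    assume le: "?d \<le> enat k"
    have ne: "?S \<noteq> {}"
    proof
      assume "?S = {}"
      then have "?d = \<infinity>" by (simp add: graph_dist_def top_enat_def)
      then show False using le by simp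
    qed
    then obtain p where "p \<in> ?S" by blast
    then have "?d \<in> (\<lambda>p. enat (length p)) ` ?S"
      unfolding graph_dist_def by (intro wellorder_InfI) (rule imageI)
    then show "walk_le n k A X"
      using le by (auto simp: walk_le_def dest!: G.awalkI_apath)
  next
    assume "walk_le n k A X"
    then obtain p where p: "G.awalk A p X" "length p \<le> k" by (auto simp: walk_le_def)
    have "?d \<le> enat (length (G.awalk_to_apath p))"
      unfolding graph_dist_def using G.apath_awalk_to_apath[OF p(1)] by (auto intro: INF_lower)
    also have "\<dots> \<le> enat k" using G.length_awalk_to_apath[OF p(1)] p(2) by simp
    finally show "?d \<le> enat k" .
  qed
qed

text \<open>For nonscalar \<open>A\<close> and \<open>X\<close> this is d(A, X) <= 3: coincidences
  among \<open>A\<close>, \<open>Y\<close>, \<open>Z\<close>, \<open>X\<close> are allowed. In this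
  form \<open>A\<close> enters only through its centralizer.\<close>

definition linked :: "nat \<Rightarrow> 'a::field mat \<Rightarrow> 'a mat \<Rightarrow> bool" where
  "linked n A X \<longleftrightarrow> (\<exists>Y \<in> centralizer n A \<inter> nonscalar n.
     \<exists>Z \<in> centralizer n X \<inter> nonscalar n. Y * Z = Z * Y)"

lemma walk_le_3_iff:
  assumes "A \<in> nonscalar n" "X \<in> nonscalar n"
  shows "walk_le n 3 A X \<longleftrightarrow> linked n A X"
proof -
  have "walk_le n 3 A X \<longleftrightarrow> (\<exists>Y \<in> nonscalar n. A * Y = Y * A \<and>
      (\<exists>Z \<in> nonscalar n. Y * Z = Z * Y \<and> Z * X = X * Z))"
    using assms unfolding numeral_3_eq_3 walk_le_Suc walk_le_0 by blast
  also have "\<dots> \<longleftrightarrow> linked n A X"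
    unfolding linked_def centralizer_def nonscalar_def by (blast intro: sym)
  finally show ?thesis .
qed

lemma graph_dist_eq_4_iff:
  assumes "A \<in> nonscalar n" "X \<in> nonscalar n"
  shows "graph_dist (with_proj (commuting_graph n)) A X = 4 \<longleftrightarrow>
    walk_le n 4 A X \<and> \<not> linked n A X" (is "?d = 4 \<longleftrightarrow> _")
proof -
  have "?d = 4 \<longleftrightarrow> ?d \<le> enat 4 \<and> \<not> ?d \<le> enat 3"
    by (cases ?d) (auto simp: numeral_eq_enat)
  then show ?thesis by (simp add: graph_dist_le_iff walk_le_3_iff[OF assms])
qed

section \<open>Centralizers of companion matrices\<close>

lemma centralizerI: "X \<in> carrier_mat n n \<Longrightarrow> A * X = X * A \<Longrightarrow> X \<in> centralizer n A"
  by (simp add: centralizer_def)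

lemma centralizerD:
  assumes "X \<in> centralizer n A"
  shows "X \<in> carrier_mat n n" "A * X = X * A"
  using assms by (auto simp: centralizer_def)

lemma index_mult_mat_sum:
  assumes "A \<in> carrier_mat n n" "B \<in> carrier_mat n n" "i < n" "j < n"
  shows "(A * B) $$ (i, j) = (\<Sum>k<n. A $$ (i, k) * B $$ (k, j))"
  using assms by (auto simp: scalar_prod_def atLeast0LessThan intro!: sum.cong)

text \<open>The last column is unconstrained: \<open>C\<close> is the companion matrix of an arbitrary monic polynomial.\<close>

definition companion :: "nat \<Rightarrow> 'a::field mat \<Rightarrow> bool" where
  "companion n C \<longleftrightarrow> C \<in> carrier_mat n n \<and>
     (\<forall>i<n. \<forall>j. Suc j < n \<longrightarrow> C $$ (i, j) = (if i = Suc j then 1 else 0))"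

lemma mult_companion_index:
  assumes "companion n C" "Y \<in> carrier_mat n n" "i < n" "Suc j < n"
  shows "(Y * C) $$ (i, j) = Y $$ (i, Suc j)"
proof -
  have "(Y * C) $$ (i, j) = (\<Sum>k<n. Y $$ (i, k) * C $$ (k, j))"
    using assms by (intro index_mult_mat_sum) (auto simp: companion_def)
  also have "\<dots> = (\<Sum>k<n. if k = Suc j then Y $$ (i, k) else 0)"
    using assms by (intro sum.cong) (auto simp: companion_def)
  also have "\<dots> = Y $$ (i, Suc j)" using assms by simp
  finally show ?thesis .
qed

text \<open>With e_j the unit vectors, C e_j = e_(j+1), hence Y e_(j+1) = Y C e_j = C Y e_j. The
  first column of \<open>Y\<close> therefore determines all of \<open>Y\<close>.\<close>

lemma companion_centralizer_next_col:
  assumes "companion n C" "Y \<in> centralizer n C" "i < n" "Suc j < n"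
  shows "Y $$ (i, Suc j) = (\<Sum>k<n. C $$ (i, k) * Y $$ (k, j))"
proof -
  have Y: "Y \<in> carrier_mat n n" "C * Y = Y * C" and C: "C \<in> carrier_mat n n"
    using assms by (auto simp: centralizer_def companion_def)
  have "Y $$ (i, Suc j) = (C * Y) $$ (i, j)"
    using mult_companion_index[OF assms(1) Y(1) assms(3,4)] Y(2) by simp
  also have "\<dots> = (\<Sum>k<n. C $$ (i, k) * Y $$ (k, j))"
    using C Y assms by (intro index_mult_mat_sum) auto
  finally show ?thesis .
qed

lemma companion_centralizer_eq_0:
  assumes "companion n C" "Y \<in> centralizer n C" "\<And>i. i < n \<Longrightarrow> Y $$ (i, 0) = 0"
  shows "Y = 0\<^sub>m n n"
proof -
  have "\<forall>i<n. Y $$ (i, j) = 0" if "j < n" for j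
    using that
  proof (induct j)
    case (Suc j)
    then show ?case
      using companion_centralizer_next_col[OF assms(1,2)] by auto
  qed (use assms in auto)
  then show ?thesis using assms(2) by (intro eq_matI) (auto simp: centralizer_def)
qed

text \<open>Applying \<open>C\<close> moves the lowest nonzero entry of a column down by one and
  keeps its value, as long as it has not reached the bottom row.\<close>

lemma companion_centralizer_top:
  assumes "companion n C" "Y \<in> centralizer n C" "\<And>i. d < i \<Longrightarrow> i < n \<Longrightarrow> Y $$ (i, 0) = 0"
    and "d + j < n"
  shows "(\<forall>i<n. d + j < i \<longrightarrow> Y $$ (i, j) = 0) \<and> Y $$ (d + j, j) = Y $$ (d, 0)"
  using \<open>d + j < n\<close>
proof (induct j)
  case (Suc j)
  then have IH: "\<And>i. i < n \<Longrightarrow> d + j < i \<Longrightarrow> Y $$ (i, j) = 0" "Y $$ (d + j, j) = Y $$ (d, 0)"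
    by auto
  have "Y $$ (i, Suc j) = (if i = 0 then 0 else Y $$ (i - 1, j))" if "i < n" for i
  proof -
    have "Y $$ (i, Suc j) = (\<Sum>k<n. C $$ (i, k) * Y $$ (k, j))"
      using that Suc.prems by (intro companion_centralizer_next_col[OF assms(1,2)]) auto
    also have "\<dots> = (\<Sum>k<n. if k = i - 1 \<and> i \<noteq> 0 then Y $$ (k, j) else 0)"
    proof (rule sum.cong)
      fix k assume k: "k \<in> {..<n}"
      show "C $$ (i, k) * Y $$ (k, j) = (if k = i - 1 \<and> i \<noteq> 0 then Y $$ (k, j) else 0)"
      proof (cases "Suc k < n")
        case True
        then show ?thesis using assms(1) that by (auto simp: companion_def)
      next
        \<comment> \<open>Here k = n - 1, the arbitrary column of \<open>C\<close>; its coefficient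
          vanishes because k > d + j.\<close>
        case False
        then have "Y $$ (k, j) = 0" using Suc.prems k by (intro IH) auto
        then show ?thesis by (simp only: mult_zero_right if_cancel)
      qed
    qed simp
    also have "\<dots> = (if i = 0 then 0 else Y $$ (i - 1, j))" using that by (cases "i = 0") auto
    finally show ?thesis .
  qed
  then show ?case using IH Suc.prems by auto
qed (use assms in auto)

lemma pow_mat_commute:
  assumes "M \<in> carrier_mat n n" "C \<in> carrier_mat n n" "M * C = C * M"
  shows "M * (C ^\<^sub>m d) = C ^\<^sub>m d * M"
proof (induct d)
  case (Suc d)
  have c: "C ^\<^sub>m d \<in> carrier_mat n n" using assms by simp
  have "M * (C ^\<^sub>m d * C) = (C ^\<^sub>m d * M) * C"
    using assms c Suc by (simp add: assoc_mult_mat[of _ n n _ n _ n, symmetric])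
  also have "\<dots> = C ^\<^sub>m d * C * M"
    using assms c by (simp add: assoc_mult_mat[of _ n n _ n _ n])
  finally show ?case by simp
qed (use assms in auto)

lemma companion_pow_index:
  assumes "companion n C" "i < n" "j + d < n"
  shows "(C ^\<^sub>m d) $$ (i, j) = (if i = j + d then 1 else 0)"
  using assms(3)
proof (induct d arbitrary: j)
  case 0
  then show ?case using assms by (auto simp: companion_def)
next
  case (Suc d)
  have c: "C ^\<^sub>m d \<in> carrier_mat n n" using assms by (simp add: companion_def)
  have "(C ^\<^sub>m Suc d) $$ (i, j) = (C ^\<^sub>m d) $$ (i, Suc j)"
    using mult_companion_index[OF assms(1) c assms(2)] Suc.prems by simp
  then show ?case using Suc by simp
qed

lemma centralizer_combination:
  assumes "Y \<in> centralizer n C" "Z \<in> centralizer n C" "C \<in> carrier_mat n n"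
  shows "Y + c \<cdot>\<^sub>m Z \<in> centralizer n C"
  using assms
  by (auto simp: centralizer_def mult_add_distrib_mat[of _ n n] add_mult_distrib_mat[of _ n n]
      mult_smult_distrib[of _ n n] mult_smult_assoc_mat[of _ n n])

text \<open>Subtracting multiples of powers of \<open>C\<close> clears the first column of \<open>Y\<close> from the bottom up, so \<open>Y\<close>
  is a polynomial in \<open>C\<close>.\<close>

lemma companion_centralizer_commutative:
  assumes "companion n C" "M \<in> centralizer n C" "Y \<in> centralizer n C"
  shows "M * Y = Y * M"
proof -
  have C: "C \<in> carrier_mat n n" and M: "M \<in> carrier_mat n n" "M * C = C * M"
    using assms by (auto simp: companion_def centralizer_def)
  \<comment> \<open>The induction is on the number \<open>d\<close> of leading entries of the first
    column that may be nonzero.\<close>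
  have "M * Y = Y * M"
    if "d \<le> n" "Y \<in> centralizer n C" "\<And>i. d \<le> i \<Longrightarrow> i < n \<Longrightarrow> Y $$ (i, 0) = 0" for d Y
    using that
  proof (induct d arbitrary: Y)
    case 0
    then have "Y = 0\<^sub>m n n" using companion_centralizer_eq_0[OF assms(1)] by auto
    then show ?case using M by simp
  next
    case (Suc d)
    \<comment> \<open>The first column of this power is the unit vector e_d.\<close>
    let ?P = "C ^\<^sub>m d"
    let ?c = "Y $$ (d, 0)"
    have P: "?P \<in> carrier_mat n n" using C by simp
    have Y: "Y \<in> carrier_mat n n" using Suc.prems by (auto simp: centralizer_def)
    have PC: "?P \<in> centralizer n C"
      using P C pow_mat_commute[OF C C refl] by (auto simp: centralizer_def)
    let ?Y = "Y + (- ?c) \<cdot>\<^sub>m ?P"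
    have "?Y \<in> centralizer n C" by (rule centralizer_combination[OF Suc.prems(2) PC C])
    moreover have "?Y $$ (i, 0) = 0" if "d \<le> i" "i < n" for i
      using that Y P Suc.prems(1,3) companion_pow_index[OF assms(1), of i 0 d] C
      by (cases "i = d") (auto simp del: pow_mat.simps)
    ultimately have "M * ?Y = ?Y * M" using Suc.prems(1) by (intro Suc.hyps) auto
    then have "?Y \<in> centralizer n M" using Y P by (intro centralizerI) auto
    moreover have "?P \<in> centralizer n M"
      by (rule centralizerI[OF P pow_mat_commute[OF M(1) C M(2)]])
    ultimately have "?Y + ?c \<cdot>\<^sub>m ?P \<in> centralizer n M"
      using M(1) by (rule centralizer_combination)
    moreover have "?Y + ?c \<cdot>\<^sub>m ?P = Y" using Y C by (intro eq_matI) auto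
    ultimately show ?case using centralizerD(2) by metis
  qed
  from this[OF le_refl assms(3)] show ?thesis by auto
qed

section \<open>The nilpotent shift and its distance from a companion matrix\<close>

definition shift_mat :: "nat \<Rightarrow> 'a::field mat" where
  "shift_mat n = mat n n (\<lambda>(i, j). if j = Suc i then 1 else 0)"

lemma shift_mat_nonscalar: "2 \<le> n \<Longrightarrow> shift_mat n \<in> nonscalar n"
proof -
  assume n: "2 \<le> n"
  have "shift_mat n \<noteq> c \<cdot>\<^sub>m 1\<^sub>m n" for c :: 'a
  proof
    assume "shift_mat n = c \<cdot>\<^sub>m 1\<^sub>m n"
    then have "shift_mat n $$ (0, 1) = (c \<cdot>\<^sub>m 1\<^sub>m n) $$ (0, 1)" by simp
    then show False using n by (simp add: shift_mat_def)
  qed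
  then show ?thesis by (auto simp: nonscalar_def scalar_mat_def shift_mat_def)
qed

text \<open>Multiplication by the shift from the left moves rows up, from the right it moves columns
  to the right. Comparing entries makes the diagonals constant and those below the main one
  zero.\<close>

lemma shift_mat_centralizer_toeplitz:
  assumes "Z \<in> centralizer n (shift_mat n)" "i < n" "j < n"
  shows "Z $$ (i, j) = (if i \<le> j then Z $$ (0, j - i) else 0)"
proof -
  let ?N = "shift_mat n :: 'a mat"
  have N: "?N \<in> carrier_mat n n" by (simp add: shift_mat_def)
  have Z: "Z \<in> carrier_mat n n" "?N * Z = Z * ?N" using assms by (auto simp: centralizer_def)
  have NZ: "(?N * Z) $$ (i, j) = Z $$ (Suc i, j)" if "Suc i < n" "j < n" for i j
  proof -
    have "(?N * Z) $$ (i, j) = (\<Sum>k<n. ?N $$ (i, k) * Z $$ (k, j))"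
      using that N Z by (intro index_mult_mat_sum) auto
    also have "\<dots> = (\<Sum>k<n. if k = Suc i then Z $$ (k, j) else 0)"
      using that by (intro sum.cong) (auto simp: shift_mat_def)
    finally show ?thesis using that by simp
  qed
  have ZN: "(Z * ?N) $$ (i, j) = (if j = 0 then 0 else Z $$ (i, j - 1))" if "i < n" "j < n" for i j
  proof -
    have "(Z * ?N) $$ (i, j) = (\<Sum>k<n. Z $$ (i, k) * ?N $$ (k, j))"
      using that N Z by (intro index_mult_mat_sum) auto
    also have "\<dots> = (\<Sum>k<n. if k = j - 1 \<and> j \<noteq> 0 then Z $$ (i, k) else 0)"
      using that by (intro sum.cong) (auto simp: shift_mat_def)
    finally show ?thesis using that by (cases "j = 0") auto
  qed
  have step: "Z $$ (Suc i, j) = (if j = 0 then 0 else Z $$ (i, j - 1))" if "Suc i < n" "j < n" for i j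
    using NZ[OF that] ZN[of i j] that Z(2) by simp
  show ?thesis using assms(2,3)
  proof (induct i arbitrary: j)
    case (Suc i)
    then show ?case using step[of i j] by (cases j) auto
  qed simp
qed

text \<open>If \<open>k\<close> is the first superdiagonal on which \<open>Z\<close> does not vanish and \<open>d\<close> is the last nonzero entry of
  the first column of \<open>Y\<close>, then \<open>Y * Z\<close> and \<open>Z * Y\<close> differ in the entry \<open>(t - k, t - d)\<close> for \<open>t = max d k\<close>.\<close>

lemma companion_not_linked_shift_mat:
  assumes "companion n C"
  shows "\<not> linked n C (shift_mat n)"
proof
  assume "linked n C (shift_mat n)"
  then obtain Y Z where Y: "Y \<in> centralizer n C" "Y \<in> carrier_mat n n" "\<not> scalar_mat n Y"
    and Z: "Z \<in> centralizer n (shift_mat n)" "Z \<in> carrier_mat n n" "\<not> scalar_mat n Z"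
    and YZ: "Y * Z = Z * Y"
    by (auto simp: linked_def nonscalar_def)
  have C: "C \<in> carrier_mat n n" using assms by (simp add: companion_def)
  note toeplitz = shift_mat_centralizer_toeplitz[OF Z(1)]
  \<comment> \<open>Otherwise the upper triangular Toeplitz matrix \<open>Z\<close> would be
    scalar.\<close>
  have ex: "\<exists>k. k < n \<and> 0 < k \<and> Z $$ (0, k) \<noteq> 0"
  proof (rule ccontr)
    assume "\<not> ?thesis"
    then have zero: "Z $$ (0, m) = 0" if "0 < m" "m < n" for m using that by blast
    have "Z = Z $$ (0, 0) \<cdot>\<^sub>m 1\<^sub>m n"
    proof (rule eq_matI)
      fix i j assume "i < dim_row (Z $$ (0, 0) \<cdot>\<^sub>m 1\<^sub>m n)" "j < dim_col (Z $$ (0, 0) \<cdot>\<^sub>m 1\<^sub>m n)"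
      then have ij: "i < n" "j < n" by auto
      then show "Z $$ (i, j) = (Z $$ (0, 0) \<cdot>\<^sub>m 1\<^sub>m n) $$ (i, j)"
        by (subst toeplitz[OF ij]) (auto intro: zero)
    qed (use Z(2) in auto)
    then show False using Z(3) unfolding scalar_mat_def by blast
  qed
  define k where "k = (LEAST k. k < n \<and> 0 < k \<and> Z $$ (0, k) \<noteq> 0)"
  have k: "k < n" "0 < k" "Z $$ (0, k) \<noteq> 0"
    using LeastI_ex[OF ex] by (auto simp: k_def)
  have below_k: "Z $$ (0, m) = 0" if "0 < m" "m < k" for m
    using not_less_Least[of m "\<lambda>k. k < n \<and> 0 < k \<and> Z $$ (0, k) \<noteq> 0"] that k(1) by (auto simp: k_def)
  define D where "D = {i. i < n \<and> 0 < i \<and> Y $$ (i, 0) \<noteq> 0}"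
  \<comment> \<open>Otherwise \<open>Y\<close> minus a scalar matrix would have first column zero
    and hence vanish.\<close>
  have "D \<noteq> {}"
  proof
    assume D: "D = {}"
    let ?Y = "Y + (- Y $$ (0, 0)) \<cdot>\<^sub>m 1\<^sub>m n"
    have "?Y = 0\<^sub>m n n"
    proof (rule companion_centralizer_eq_0[OF assms])
      show "?Y \<in> centralizer n C"
        using C by (intro centralizer_combination Y(1)) (auto simp: centralizer_def)
      show "?Y $$ (i, 0) = 0" if "i < n" for i
        using D Y(2) that by (cases "i = 0") (auto simp: D_def)
    qed
    moreover have "Y = ?Y + Y $$ (0, 0) \<cdot>\<^sub>m 1\<^sub>m n" using Y(2) by (intro eq_matI) auto
    ultimately have "Y = Y $$ (0, 0) \<cdot>\<^sub>m 1\<^sub>m n" by (metis left_add_zero_mat one_carrier_mat smult_carrier_mat)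
    then show False using Y(3) unfolding scalar_mat_def by blast
  qed
  define d where "d = Max D"
  have fin: "finite D" by (simp add: D_def)
  have "d \<in> D" using fin \<open>D \<noteq> {}\<close> by (simp add: d_def)
  then have d: "d < n" "0 < d" "Y $$ (d, 0) \<noteq> 0" by (auto simp: D_def)
  have above_d: "Y $$ (i, 0) = 0" if "d < i" "i < n" for i
  proof (rule ccontr)
    assume "Y $$ (i, 0) \<noteq> 0"
    with that have "i \<in> D" by (simp add: D_def)
    then show False using Max_ge[OF fin, of i] that by (simp add: d_def)
  qed
  \<comment> \<open>The maximum makes both t - k and t - d honest differences with t < n; moreover t
    - d < k, as \<open>d\<close> and \<open>k\<close> are positive.\<close>
  define t where "t = max d k"
  define j where "j = t - d"
  have t: "t < n" "k \<le> t" "d + j = t" "j < n" "j < k" "t - k < n"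
    using d k by (auto simp: t_def j_def)
  have top: "\<And>i. i < n \<Longrightarrow> t < i \<Longrightarrow> Y $$ (i, j) = 0" "Y $$ (t, j) = Y $$ (d, 0)"
    using companion_centralizer_top[OF assms Y(1), of d j] above_d t by auto
  have "(Z * Y) $$ (t - k, j) = (\<Sum>m<n. Z $$ (t - k, m) * Y $$ (m, j))"
    using t Y Z by (intro index_mult_mat_sum) auto
  \<comment> \<open>Row t - k of \<open>Z\<close> lives in column t - k and in columns from
    \<open>t\<close> on, column \<open>j\<close> of \<open>Y\<close> in rows up to \<open>t\<close>.
    They meet only at m = t - k and m = t.\<close>
  also have "\<dots> = (\<Sum>m<n. (if m = t - k then Z $$ (0, 0) * Y $$ (t - k, j) else 0) +
      (if m = t then Z $$ (0, k) * Y $$ (d, 0) else 0))"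
  proof (rule sum.cong)
    fix m assume "m \<in> {..<n}"
    then have m: "m < n" by simp
    consider "m < t - k" | "m = t - k" | "t - k < m" "m < t" | "m = t" | "t < m" by linarith
    then show "Z $$ (t - k, m) * Y $$ (m, j) = (if m = t - k then Z $$ (0, 0) * Y $$ (t - k, j) else 0) +
      (if m = t then Z $$ (0, k) * Y $$ (d, 0) else 0)"
    proof cases
      case 3
      then have "Z $$ (0, m - (t - k)) = 0" using t by (intro below_k) auto
      then show ?thesis using 3 toeplitz[of "t - k" m] t m by simp
    qed (use toeplitz[of "t - k" m] t m top k in auto)
  qed simp
  also have "\<dots> = Z $$ (0, 0) * Y $$ (t - k, j) + Z $$ (0, k) * Y $$ (d, 0)"
    using t by (simp add: sum.distrib)
  finally have ZY: "(Z * Y) $$ (t - k, j) = \<dots>" .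
  have "(Y * Z) $$ (t - k, j) = (\<Sum>m<n. Y $$ (t - k, m) * Z $$ (m, j))"
    using t Y Z by (intro index_mult_mat_sum) auto
  \<comment> \<open>Since j < k, column \<open>j\<close> of \<open>Z\<close> has only its diagonal
    entry.\<close>
  also have "\<dots> = (\<Sum>m<n. if m = j then Y $$ (t - k, j) * Z $$ (0, 0) else 0)"
  proof (rule sum.cong)
    fix m assume "m \<in> {..<n}"
    then show "Y $$ (t - k, m) * Z $$ (m, j) = (if m = j then Y $$ (t - k, j) * Z $$ (0, 0) else 0)"
      using toeplitz[of m j] t below_k[of "j - m"] by auto
  qed simp
  also have "\<dots> = Y $$ (t - k, j) * Z $$ (0, 0)" using t by simp
  finally have "Z $$ (0, k) * Y $$ (d, 0) = 0" using ZY YZ by (simp add: mult.commute)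
  then show False using k d by simp
qed

section \<open>Similarity\<close>

text \<open>The lower bound in "some vertex has distance 4"; the upper bound is supplied for all
  pairs by \<open>walk_le_4\<close>.\<close>

definition far :: "nat \<Rightarrow> 'a::field mat \<Rightarrow> bool" where
  "far n A \<longleftrightarrow> (\<exists>X \<in> nonscalar n. \<not> linked n A X)"

text \<open>The link between the two conditions of the theorem: over an algebraically closed field
  it follows from \<open>far\<close> if \<open>n\<close> is at least 2, and it implies
  minimality.\<close>

definition commutative_centralizer :: "nat \<Rightarrow> 'a::field mat \<Rightarrow> bool" where
  "commutative_centralizer n A \<longleftrightarrow>
     (\<forall>Y \<in> centralizer n A. \<forall>Z \<in> centralizer n A. Y * Z = Z * Y)"

lemma nonscalarD: "X \<in> nonscalar n \<Longrightarrow> X \<in> carrier_mat n n"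
  by (simp add: nonscalar_def)

text \<open>Both inverse laws are assumed, so that exchanging \<open>P\<close> and \<open>Q\<close>
  gives another instance, the inverse conjugation.\<close>

locale mat_conj =
  fixes n :: nat and P Q :: "'a::field mat"
  assumes P: "P \<in> carrier_mat n n" and Q: "Q \<in> carrier_mat n n"
    and PQ: "P * Q = 1\<^sub>m n" and QP: "Q * P = 1\<^sub>m n"
begin

lemma swap: "mat_conj n Q P"
  using P Q PQ QP by unfold_locales

definition cj :: "'a mat \<Rightarrow> 'a mat" where
  "cj X = P * X * Q"

lemma cj_carrier: "X \<in> carrier_mat n n \<Longrightarrow> cj X \<in> carrier_mat n n"
  using P Q by (simp add: cj_def)

lemma cj_mult:
  assumes "X \<in> carrier_mat n n" "Y \<in> carrier_mat n n"
  shows "cj (X * Y) = cj X * cj Y"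
proof -
  have "cj X * cj Y = P * X * (Q * (P * (Y * Q)))"
    using P Q assms by (simp add: cj_def assoc_mult_mat[of _ n n _ n _ n])
  also have "Q * (P * (Y * Q)) = Q * P * (Y * Q)"
    using P Q assms by (intro assoc_mult_mat[symmetric]) auto
  finally show ?thesis
    using P Q assms by (simp add: cj_def QP assoc_mult_mat[of _ n n _ n _ n])
qed

lemma cj_cancel:
  assumes "X \<in> carrier_mat n n"
  shows "mat_conj.cj Q P (cj X) = X"
proof -
  have "mat_conj.cj Q P (cj X) = Q * (P * (X * (Q * P)))"
    using P Q assms by (simp add: cj_def mat_conj.cj_def[OF swap] assoc_mult_mat[of _ n n _ n _ n])
  also have "\<dots> = Q * (P * X)" using assms by (simp add: QP)
  also have "\<dots> = Q * P * X" using P Q assms by (intro assoc_mult_mat[symmetric]) auto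
  finally show ?thesis using assms by (simp add: QP)
qed

lemma cj_centralizer:
  assumes "A \<in> carrier_mat n n" "Y \<in> centralizer n A"
  shows "cj Y \<in> centralizer n (cj A)"
proof (rule centralizerI)
  note Y = centralizerD[OF assms(2)]
  show "cj Y \<in> carrier_mat n n" by (rule cj_carrier[OF Y(1)])
  show "cj A * cj Y = cj Y * cj A"
    using arg_cong[OF Y(2), of cj] assms(1) Y(1) by (simp add: cj_mult)
qed

lemma cj_scalar: "scalar_mat n X \<Longrightarrow> scalar_mat n (cj X)"
proof -
  have "cj (c \<cdot>\<^sub>m 1\<^sub>m n) = c \<cdot>\<^sub>m 1\<^sub>m n" for c
    using P Q mult_smult_distrib[OF P one_carrier_mat, of c] mult_smult_assoc_mat[OF P Q, of c]
    by (simp add: cj_def PQ)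
  then show "scalar_mat n X \<Longrightarrow> scalar_mat n (cj X)" unfolding scalar_mat_def by metis
qed

end

section \<open>Properties preserved by conjugation\<close>

context mat_conj
begin

interpretation sw: mat_conj n Q P by (rule swap)

lemma cj_nonscalar:
  assumes "X \<in> nonscalar n"
  shows "cj X \<in> nonscalar n"
  using assms cj_carrier sw.cj_scalar[of "cj X"] cj_cancel by (auto simp: nonscalar_def)

lemma linked_cj:
  assumes "linked n A X" "A \<in> carrier_mat n n" "X \<in> carrier_mat n n"
  shows "linked n (cj A) (cj X)"
proof -
  obtain Y Z where Y: "Y \<in> centralizer n A" "Y \<in> nonscalar n"
    and Z: "Z \<in> centralizer n X" "Z \<in> nonscalar n" and YZ: "Y * Z = Z * Y"
    using assms(1) by (auto simp: linked_def)
  have "cj Y * cj Z = cj Z * cj Y"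
    using YZ Y(2) Z(2) by (simp flip: cj_mult add: nonscalar_def)
  then show ?thesis
    using Y Z assms cj_centralizer cj_nonscalar unfolding linked_def by blast
qed

text \<open>The witness is conjugated along with \<open>A\<close>; a link between the images would
  be carried back by the inverse conjugation.\<close>

lemma far_cj:
  assumes "far n A" "A \<in> carrier_mat n n"
  shows "far n (cj A)"
proof -
  obtain X where X: "X \<in> nonscalar n" "\<not> linked n A X" using assms(1) by (auto simp: far_def)
  have "\<not> linked n (cj A) (cj X)"
    using mat_conj.linked_cj[OF swap, of "cj A" "cj X"] X assms(2) nonscalarD[OF X(1)]
    by (auto simp: cj_cancel cj_carrier)
  then show ?thesis using cj_nonscalar[OF X(1)] by (auto simp: far_def)
qed

lemma commutative_centralizer_cj:
  assumes "commutative_centralizer n A" "A \<in> carrier_mat n n"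
  shows "commutative_centralizer n (cj A)"
  unfolding commutative_centralizer_def
proof (intro ballI)
  fix Y Z assume YZ: "Y \<in> centralizer n (cj A)" "Z \<in> centralizer n (cj A)"
  have "sw.cj Y \<in> centralizer n A" "sw.cj Z \<in> centralizer n A"
    using YZ sw.cj_centralizer[of "cj A"] assms(2) by (auto simp: cj_cancel cj_carrier)
  then have "sw.cj Y * sw.cj Z = sw.cj Z * sw.cj Y"
    using assms(1) by (auto simp: commutative_centralizer_def)
  then have "cj (sw.cj (Y * Z)) = cj (sw.cj (Z * Y))"
    using YZ[THEN centralizerD(1)] by (simp add: sw.cj_mult)
  then show "Y * Z = Z * Y"
    using YZ[THEN centralizerD(1)] by (simp add: sw.cj_cancel)
qed

end

lemma similar_mat_conj:
  assumes "similar_mat A B" "A \<in> carrier_mat n n"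
  obtains P Q where "mat_conj n P Q" "A = mat_conj.cj P Q B" "B \<in> carrier_mat n n"
proof -
  obtain P Q where w: "similar_mat_wit A B P Q" using assms(1) by (auto simp: similar_mat_def)
  note w = similar_mat_witD2[OF assms(2) w]
  have c: "mat_conj n P Q" using w by unfold_locales
  show ?thesis by (rule that[OF c]) (use w in \<open>auto simp: mat_conj.cj_def[OF c]\<close>)
qed

section \<open>Matrices of rank one\<close>

lemma outer_index:
  assumes "U \<in> carrier_mat n 1" "W \<in> carrier_mat 1 n" "i < n" "j < n"
  shows "(U * W) $$ (i, j) = U $$ (i, 0) * W $$ (0, j)"
  using assms by (simp add: scalar_prod_def)

text \<open>If \<open>U * W\<close> were scalar with a nonzero entry, all its diagonal entries,
  hence all entries of \<open>U\<close>, would be nonzero. Then a column with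
  \<open>W $$ (0, j)\<close> nonzero has a nonzero entry off the diagonal.\<close>

lemma outer_nonscalar:
  fixes U :: "'a::field mat"
  assumes U: "U \<in> carrier_mat n 1" "U \<noteq> 0\<^sub>m n 1" and W: "W \<in> carrier_mat 1 n" "W \<noteq> 0\<^sub>m 1 n"
    and n: "2 \<le> n"
  shows "U * W \<in> nonscalar n"
proof -
  obtain i where i: "i < n" "U $$ (i, 0) \<noteq> 0"
    using U by (metis One_nat_def carrier_matD eq_matI index_zero_mat less_Suc0)
  obtain j where j: "j < n" "W $$ (0, j) \<noteq> 0"
    using W by (metis One_nat_def carrier_matD eq_matI index_zero_mat less_Suc0)
  note entry = outer_index[OF U(1) W(1)]
  have "U * W \<noteq> c \<cdot>\<^sub>m 1\<^sub>m n" for c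
  proof
    assume eq: "U * W = c \<cdot>\<^sub>m 1\<^sub>m n"
    have entries: "U $$ (r, 0) * W $$ (0, s) = (if r = s then c else 0)" if "r < n" "s < n" for r s
      using entry[OF that] that unfolding eq by auto
    have "i = j" using entries[OF i(1) j(1)] i j by (auto split: if_splits)
    define k where "k = (if i = 0 then 1 else 0 :: nat)"
    have k: "k < n" "k \<noteq> i" using n by (auto simp: k_def)
    have "c \<noteq> 0" using entries[OF i(1) j(1)] i j \<open>i = j\<close> by auto
    then have "U $$ (k, 0) \<noteq> 0" using entries[of k k] k by auto
    then show False using entries[of k j] k i j \<open>i = j\<close> by auto
  qed
  then show ?thesis using U W by (auto simp: nonscalar_def scalar_mat_def)
qed

lemma outer_centralizer:
  assumes A: "A \<in> carrier_mat n n" and U: "U \<in> carrier_mat n 1" and W: "W \<in> carrier_mat 1 n"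
    and "A * U = e \<cdot>\<^sub>m U" "W * A = e \<cdot>\<^sub>m W"
  shows "U * W \<in> centralizer n A"
proof (rule centralizerI)
  have "A * (U * W) = A * U * W" using A U W by simp
  also have "\<dots> = e \<cdot>\<^sub>m (U * W)" using U W assms(4) by (simp add: mult_smult_assoc_mat)
  also have "\<dots> = U * (W * A)" using U W assms(5) by (simp add: mult_smult_distrib)
  also have "\<dots> = U * W * A" using A U W by simp
  finally show "A * (U * W) = U * W * A" .
qed (use U W in simp)

text \<open>Two matrices of rank one will be shown to commute by applying this in both orders, so
  that both products are zero.\<close>

lemma outer_mult_outer_eq_0:
  assumes U: "U \<in> carrier_mat n 1" and W: "W \<in> carrier_mat 1 n"
    and X: "X \<in> carrier_mat n 1" and Y: "Y \<in> carrier_mat 1 n"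
    and WX: "W * X = 0\<^sub>m 1 1"
  shows "(U * W) * (X * Y) = 0\<^sub>m n n"
proof -
  have "(U * W) * (X * Y) = U * (W * (X * Y))" using U W X Y by (intro assoc_mult_mat) auto
  also have "W * (X * Y) = W * X * Y" using W X Y by (simp add: assoc_mult_mat)
  finally show ?thesis using U Y WX by simp
qed

text \<open>Two linear conditions on at least three unknowns have a nonzero solution: they are rows
  0 and 1 of a square matrix that is singular because its row 2 is zero.\<close>

lemma exists_orthogonal_column:
  fixes R S :: "'a::field mat"
  assumes n: "3 \<le> n" and R: "R \<in> carrier_mat 1 n" and S: "S \<in> carrier_mat 1 n"
  shows "\<exists>U \<in> carrier_mat n 1. U \<noteq> 0\<^sub>m n 1 \<and> R * U = 0\<^sub>m 1 1 \<and> S * U = 0\<^sub>m 1 1"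
proof -
  define c where "c i = (if i = 0 then row R 0 else if i = Suc 0 then row S 0 else 0\<^sub>v n)" for i
  define M where "M = mat\<^sub>r n n (\<lambda>i. if i = 2 then 0\<^sub>v n else c i)"
  have c: "c \<in> {0..<n} \<rightarrow> carrier_vec n" using R S by (auto simp: c_def intro!: carrier_vecI)
  have M: "M \<in> carrier_mat n n" by (simp add: M_def)
  have "det M = 0" unfolding M_def by (rule det_row_0) (use n c in auto)
  then obtain v where v: "v \<in> carrier_vec n" "v \<noteq> 0\<^sub>v n" "M *\<^sub>v v = 0\<^sub>v n"
    using det_0_iff_vec_prod_zero_field[OF M] by auto
  have row: "row M 0 = row R 0" "row M 1 = row S 0"
    using n R S by (auto simp: M_def c_def)
  have 0: "(M *\<^sub>v v) $ 0 = 0" "(M *\<^sub>v v) $ 1 = 0" using n v(3) by auto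
  have dot: "row R 0 \<bullet> v = 0" "row S 0 \<bullet> v = 0"
    using 0 n M row by (auto simp del: index_mult_mat_vec simp: index_mult_mat_vec)
  define U where "U = mat_of_cols n [v]"
  have U: "U \<in> carrier_mat n 1" "col U 0 = v" using v by (auto simp: U_def)
  have "U \<noteq> 0\<^sub>m n 1"
  proof
    assume "U = 0\<^sub>m n 1"
    then have "col U 0 = 0\<^sub>v n" by simp
    then show False using U v by simp
  qed
  moreover have "R * U = 0\<^sub>m 1 1" "S * U = 0\<^sub>m 1 1"
    using R S U dot by (auto intro!: eq_matI)
  ultimately show ?thesis using U by blast
qed

lemma exists_orthogonal_row:
  fixes X Y :: "'a::field mat"
  assumes n: "3 \<le> n" and X: "X \<in> carrier_mat n 1" and Y: "Y \<in> carrier_mat n 1"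
  shows "\<exists>W \<in> carrier_mat 1 n. W \<noteq> 0\<^sub>m 1 n \<and> W * X = 0\<^sub>m 1 1 \<and> W * Y = 0\<^sub>m 1 1"
proof -
  obtain U where U: "U \<in> carrier_mat n 1" "U \<noteq> 0\<^sub>m n 1"
      "transpose_mat X * U = 0\<^sub>m 1 1" "transpose_mat Y * U = 0\<^sub>m 1 1"
    using exists_orthogonal_column[OF n, of "transpose_mat X" "transpose_mat Y"] X Y by auto
  let ?W = "transpose_mat U"
  have "?W \<noteq> 0\<^sub>m 1 n" using U by (metis transpose_transpose zero_transpose_mat)
  moreover have "?W * X = transpose_mat (transpose_mat X * U)" "?W * Y = transpose_mat (transpose_mat Y * U)"
    using U(1) X Y by (simp_all add: transpose_mult[of _ 1 n _ 1])
  ultimately show ?thesis using U by (intro bexI[of _ ?W]) (simp_all del: One_nat_def)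
qed

section \<open>Jordan form over an algebraically closed field\<close>

lemma mat_conj_if_trivial_kernel:
  fixes P :: "'a::field mat"
  assumes P: "P \<in> carrier_mat n n"
    and ker: "\<And>v. v \<in> carrier_vec n \<Longrightarrow> P *\<^sub>v v = 0\<^sub>v n \<Longrightarrow> v = 0\<^sub>v n"
  obtains Q where "mat_conj n P Q"
proof -
  have "det P \<noteq> 0" using det_0_iff_vec_prod_zero_field[OF P] ker by auto
  from det_non_zero_imp_unit[OF P this, of "()"]
  obtain Q where "Q \<in> carrier_mat n n" "Q * P = 1\<^sub>m n" "P * Q = 1\<^sub>m n"
    by (auto simp: Units_def ring_mat_def)
  with P show ?thesis by (intro that[of Q]) unfold_locales
qed

text \<open>Exchange: if \<open>v\<close> has a nonzero entry at \<open>k\<close>, it may replace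
  the unit vector e_k in the standard basis.\<close>

lemma mat_conj_first_column:
  fixes v :: "'a::field vec"
  assumes v: "v \<in> carrier_vec n" "v \<noteq> 0\<^sub>v n"
  obtains P Q where "mat_conj n P Q" "P *\<^sub>v unit_vec n 0 = v"
proof -
  obtain k where k: "k < n" "v $ k \<noteq> 0" using v by (metis carrier_vecD eq_vecI index_zero_vec)
  \<comment> \<open>Column \<open>j\<close> > 0 of \<open>P\<close> is the unit vector with index
    \<open>s j\<close>. If \<open>k\<close> > 0, e_0 moves to column \<open>k\<close>, since
    \<open>v\<close> occupies column 0.\<close>
  define s where "s j = (if j = k then 0 else j)" for j
  have s: "s j < n" "0 < j \<Longrightarrow> s j \<noteq> k" if "j < n" for j using k that by (auto simp: s_def)
  define P where "P = mat n n (\<lambda>(i, j). if j = 0 then v $ i else if i = s j then 1 else 0)"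
  have P: "P \<in> carrier_mat n n" by (simp add: P_def)
  have Px: "(P *\<^sub>v x) $ i = v $ i * x $ 0 + (\<Sum>j<n. if j \<noteq> 0 \<and> i = s j then x $ j else 0)"
    if "x \<in> carrier_vec n" "i < n" for x i
  proof -
    have "(P *\<^sub>v x) $ i = (\<Sum>j<n. P $$ (i, j) * x $ j)"
      using that P by (auto simp: scalar_prod_def atLeast0LessThan intro!: sum.cong)
    also have "\<dots> = (\<Sum>j<n. (if j = 0 then v $ i * x $ 0 else 0) +
        (if j \<noteq> 0 \<and> i = s j then x $ j else 0))"
      using that by (intro sum.cong) (auto simp: P_def)
    finally show ?thesis using that by (simp add: sum.distrib)
  qed
  obtain Q where "mat_conj n P Q"
  proof (rule mat_conj_if_trivial_kernel[OF P])
    fix x assume x: "x \<in> carrier_vec n" "P *\<^sub>v x = 0\<^sub>v n"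
    have zero: "v $ i * x $ 0 + (\<Sum>j<n. if j \<noteq> 0 \<and> i = s j then x $ j else 0) = 0"
      if "i < n" for i using Px[OF x(1) that] x(2) that by simp
    \<comment> \<open>Row \<open>k\<close> of \<open>P\<close> is nonzero only in the column
      \<open>v\<close>, which isolates \<open>x $ 0\<close>.\<close>
    have "(\<Sum>j<n. if j \<noteq> 0 \<and> k = s j then x $ j else 0) = 0"
      using s by (intro sum.neutral) auto
    then have x0: "x $ 0 = 0" using zero[OF k(1)] k(2) by simp
    have "x $ j = 0" if j: "j < n" "0 < j" for j
    proof -
      have "(\<Sum>l<n. if l \<noteq> 0 \<and> s j = s l then x $ l else 0) = (\<Sum>l<n. if l = j then x $ l else 0)"
        using j by (intro sum.cong) (auto simp: s_def split: if_splits)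
      then show ?thesis using zero[of "s j"] s[OF j(1)] x0 j by simp
    qed
    then have "x $ j = 0" if "j < n" for j using x0 that by (cases "j = 0") auto
    then show "x = 0\<^sub>v n" using x(1) by (intro eq_vecI) auto
  qed
  moreover have "P *\<^sub>v unit_vec n 0 = v"
    using v P by (intro eq_vecI) (auto simp: P_def)
  ultimately show ?thesis by (rule that)
qed

text \<open>Taking an eigenvector as first basis vector splits off a block of size 1; the induction
  hypothesis triangularizes the remaining diagonal block.\<close>

lemma triangularizable:
  fixes A :: "'a::alg_closed_field mat"
  assumes "A \<in> carrier_mat n n"
  shows "\<exists>B \<in> carrier_mat n n. upper_triangular B \<and> similar_mat A B"
  using assms
proof (induct n arbitrary: A)
  case 0
  then show ?case by (intro bexI[of _ A]) (auto intro!: similar_mat_refl)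
next
  case (Suc n)
  let ?N = "Suc n"
  let ?u = "unit_vec ?N 0 :: 'a vec"
  obtain e where "poly (char_poly A) e = 0"
    using alg_closed_imp_poly_has_root[of "char_poly A"] degree_monic_char_poly[OF Suc.prems] by auto
  then have "eigenvalue A e" using eigenvalue_root_char_poly[OF Suc.prems] by simp
  then obtain v where v: "v \<in> carrier_vec ?N" "v \<noteq> 0\<^sub>v ?N" "A *\<^sub>v v = e \<cdot>\<^sub>v v"
    using Suc.prems by (auto simp: eigenvalue_def eigenvector_def)
  obtain P Q where conj: "mat_conj ?N P Q" and Pu: "P *\<^sub>v ?u = v"
    using mat_conj_first_column[OF v(1,2)] .
  interpret mat_conj ?N P Q by fact
  interpret sw: mat_conj ?N Q P by (rule swap)
  let ?A = "sw.cj A"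
  have A': "?A \<in> carrier_mat ?N ?N" using Suc.prems by (rule sw.cj_carrier)
  have sim: "similar_mat A ?A"
    using Suc.prems A' P Q PQ QP sw.cj_cancel[OF Suc.prems]
    by (intro similar_matI[of _ _ P Q ?N]) (auto simp: cj_def)
  have "Q *\<^sub>v v = (Q * P) *\<^sub>v ?u" using P Q Pu by (simp add: assoc_mult_mat_vec)
  then have Qv: "Q *\<^sub>v v = ?u" using QP by simp
  have "?A *\<^sub>v ?u = Q *\<^sub>v (A *\<^sub>v (P *\<^sub>v ?u))"
    using P Q Suc.prems by (simp add: sw.cj_def assoc_mult_mat_vec[of _ ?N ?N _ ?N])
  also have "\<dots> = e \<cdot>\<^sub>v ?u" using Q v Pu Qv by (simp add: mult_mat_vec)
  finally have eig: "?A *\<^sub>v ?u = e \<cdot>\<^sub>v ?u" .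
  have col0: "?A $$ (i, 0) = (if i = 0 then e else 0)" if "i < ?N" for i
  proof -
    have "?A $$ (i, 0) = (?A *\<^sub>v ?u) $ i" using A' that by simp
    then show ?thesis unfolding eig using that by simp
  qed
  define E where "E = mat 1 1 (\<lambda>_. e)"
  define R where "R = mat 1 n (\<lambda>(i, j). ?A $$ (0, Suc j))"
  define D where "D = mat n n (\<lambda>(i, j). ?A $$ (Suc i, Suc j))"
  have E: "E \<in> carrier_mat 1 1" and R: "R \<in> carrier_mat 1 n" and D: "D \<in> carrier_mat n n"
    by (auto simp: E_def R_def D_def)
  have blocks: "?A = four_block_mat E R (0\<^sub>m n 1) D"
    using A' col0 by (intro eq_matI) (auto simp: E_def R_def D_def)
  obtain T where T: "T \<in> carrier_mat n n" "upper_triangular T" "similar_mat D T"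
    using Suc.hyps[OF D] by blast
  obtain R' where R': "R' \<in> carrier_mat 1 n"
    and sim': "similar_mat ?A (four_block_mat E R' (0\<^sub>m n 1) T)"
    using similar_mat_four_block_0_ex[OF similar_mat_refl[OF E] T(3) R E D] unfolding blocks by blast
  let ?B = "four_block_mat E R' (0\<^sub>m n 1) T"
  have "?B \<in> carrier_mat ?N ?N" using E T by (intro carrier_matI) auto
  moreover have "upper_triangular ?B"
    using T E by (intro upper_triangularI) (auto simp: E_def)
  ultimately show ?case using similar_mat_trans[OF sim sim'] by blast
qed

text \<open>A Jordan matrix is described by the monotone map \<open>b\<close> that sends a position to the index of its
  block, and the map \<open>f\<close> that sends the index of a block to its eigenvalue.\<close>

definition jordan_mat :: "nat \<Rightarrow> (nat \<Rightarrow> nat) \<Rightarrow> (nat \<Rightarrow> 'a::field) \<Rightarrow> 'a mat" where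
  "jordan_mat n b f =
     mat n n (\<lambda>(i, j). if i = j then f (b i) else if j = Suc i \<and> b i = b j then 1 else 0)"

lemma jordan_mat_carrier [simp]: "jordan_mat n b f \<in> carrier_mat n n"
  by (simp add: jordan_mat_def)

lemma jordan_mat_mult_index:
  assumes "M \<in> carrier_mat n n" "i < n" "j < n"
  shows "(jordan_mat n b f * M) $$ (i, j) =
    f (b i) * M $$ (i, j) + (if Suc i < n \<and> b (Suc i) = b i then M $$ (Suc i, j) else 0)"
proof -
  let ?J = "jordan_mat n b f"
  have "(?J * M) $$ (i, j) = (\<Sum>k<n. ?J $$ (i, k) * M $$ (k, j))"
    using assms by (intro index_mult_mat_sum) auto
  also have "\<dots> = (\<Sum>k<n. (if k = i then f (b i) * M $$ (i, j) else 0) +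
      (if k = Suc i \<and> b (Suc i) = b i then M $$ (Suc i, j) else 0))"
    using assms by (intro sum.cong) (auto simp: jordan_mat_def)
  finally show ?thesis
    using assms by (cases "b (Suc i) = b i") (auto simp: sum.distrib)
qed

text \<open>On each block both matrices are a scalar matrix plus the same nilpotent shift, as
  \<open>b\<close> is shared. This allows the eigenvalues to be replaced later.\<close>

lemma jordan_mat_commute:
  fixes f g :: "nat \<Rightarrow> 'a::field"
  shows "jordan_mat n b f * jordan_mat n b g = jordan_mat n b g * jordan_mat n b f"
proof (rule eq_matI)
  fix i j assume "i < dim_row (jordan_mat n b g * jordan_mat n b f)"
    "j < dim_col (jordan_mat n b g * jordan_mat n b f)"
  then have "i < n" "j < n" by (auto simp: jordan_mat_def)
  then show "(jordan_mat n b f * jordan_mat n b g) $$ (i, j) =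
      (jordan_mat n b g * jordan_mat n b f) $$ (i, j)"
    unfolding jordan_mat_mult_index[OF jordan_mat_carrier \<open>i < n\<close> \<open>j < n\<close>]
    by (auto simp: jordan_mat_def)
qed (auto simp: jordan_mat_def)

lemma jordan_matrix_eq_jordan_mat:
  "\<exists>b f. mono b \<and> jordan_matrix n_as = jordan_mat (sum_list (map fst n_as)) b f"
proof (induct n_as)
  case Nil
  have "jordan_matrix [] = jordan_mat 0 id f" for f :: "nat \<Rightarrow> 'a"
    by (rule eq_matI) (simp_all only: jordan_matrix_def jordan_mat_def list.map diag_block_mat.simps
        index_zero_mat dim_row_mat dim_col_mat not_less_zero)
  moreover have "mono (id :: nat \<Rightarrow> nat)" by (rule monoI) simp
  ultimately show ?case by (metis list.map(1) sum_list.Nil)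
next
  case (Cons na n_as)
  obtain k a where na: "na = (k, a)" by (rule prod.exhaust)
  from Cons obtain b f where b: "mono b"
    and eq: "jordan_matrix n_as = jordan_mat (sum_list (map fst n_as)) b f"
    by (elim exE conjE)
  let ?m = "sum_list (map fst n_as)"
  \<comment> \<open>The new block comes first and gets index 0, so the indices of the others go up
    by one.\<close>
  define b' where "b' i = (if i < k then 0 else Suc (b (i - k)))" for i
  define f' where "f' p = (case p of 0 \<Rightarrow> a | Suc q \<Rightarrow> f q)" for p
  have "mono b'"
  proof (rule monoI)
    fix i j :: nat assume "i \<le> j"
    then have "b (i - k) \<le> b (j - k)" by (intro monoD[OF b] diff_le_mono)
    then show "b' i \<le> b' j" using \<open>i \<le> j\<close> by (simp add: b'_def)
  qed
  moreover have "jordan_matrix (na # n_as) = jordan_mat (k + ?m) b' f'"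
  proof -
    have "jordan_matrix (na # n_as) =
        four_block_mat (jordan_block k a) (0\<^sub>m k ?m) (0\<^sub>m ?m k) (jordan_mat ?m b f)"
      unfolding eq[symmetric] using jordan_matrix_dim[of n_as]
      by (simp only: jordan_matrix_def na Let_def list.map prod.case diag_block_mat.simps
          jordan_block_index)
    also have "\<dots> = jordan_mat (k + ?m) b' f'"
      by (intro eq_matI) (auto simp: jordan_mat_def b'_def f'_def Suc_diff_le)
    finally show ?thesis .
  qed
  ultimately show ?case by (auto simp: na)
qed

text \<open>The passage through a triangular matrix is what \<open>triangular_to_jnf_vector\<close>
  asks for.\<close>

lemma exists_similar_jordan_mat:
  fixes A :: "'a::alg_closed_field mat"
  assumes A: "A \<in> carrier_mat n n"
  obtains b f where "mono b" "similar_mat A (jordan_mat n b f)"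
proof -
  obtain B where B: "B \<in> carrier_mat n n" "upper_triangular B" "similar_mat A B"
    using triangularizable[OF A] by blast
  let ?ns = "triangular_to_jnf_vector B"
  have "similar_mat A (jordan_matrix ?ns)"
    using triangular_to_jnf_vector[OF B(1,2)] B(3) similar_mat_trans
    unfolding jordan_nf_def by blast
  moreover obtain b f where bf: "mono b" "jordan_matrix ?ns = jordan_mat (sum_list (map fst ?ns)) b f"
    using jordan_matrix_eq_jordan_mat by blast
  ultimately have sim: "similar_mat A (jordan_mat (sum_list (map fst ?ns)) b f)" by simp
  have "sum_list (map fst ?ns) = n"
  proof -
    obtain m where "A \<in> carrier_mat m m" "jordan_mat (sum_list (map fst ?ns)) b f \<in> carrier_mat m m"
      using similar_matD[OF sim] by blast
    then show ?thesis using A jordan_mat_carrier by (metis carrier_matD(1))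
  qed
  with sim bf(1) show ?thesis by (intro that) auto
qed

section \<open>Eigenvectors\<close>

text \<open>The first unit vector of a block is a right eigenvector; by the next lemma, the last one
  is a left eigenvector.\<close>

lemma jordan_mat_first_column:
  assumes "k < n" "\<And>r. Suc r = k \<Longrightarrow> b r \<noteq> b k" "r < n"
  shows "jordan_mat n b f $$ (r, k) = (if r = k then f (b k) else 0)"
  using assms by (auto simp: jordan_mat_def)

lemma jordan_mat_last_row:
  assumes "k < n" "Suc k < n \<Longrightarrow> b (Suc k) \<noteq> b k" "r < n"
  shows "jordan_mat n b f $$ (k, r) = (if r = k then f (b k) else 0)"
  using assms by (auto simp: jordan_mat_def)

lemma obtain_first_of_block:
  fixes b :: "nat \<Rightarrow> nat"
  assumes "i < n"
  obtains k where "k < n" "b k = b i" "\<And>r. Suc r = k \<Longrightarrow> b r \<noteq> b k"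
proof -
  define k where "k = (LEAST k. b k = b i)"
  have "b k = b i" unfolding k_def by (rule LeastI) simp
  moreover have "k \<le> i" unfolding k_def by (rule Least_le) simp
  moreover have "b r \<noteq> b k" if "Suc r = k" for r
    using not_less_Least[of r "\<lambda>k. b k = b i"] that calculation(1) by (simp add: k_def[symmetric])
  ultimately show ?thesis using assms by (intro that[of k]) auto
qed

lemma obtain_last_of_block:
  fixes b :: "nat \<Rightarrow> nat"
  assumes "i < n"
  obtains k where "k < n" "b k = b i" "Suc k < n \<Longrightarrow> b (Suc k) \<noteq> b k"
proof -
  define k where "k = Max {k. k < n \<and> b k = b i}"
  have fin: "finite {k. k < n \<and> b k = b i}" by simp
  have "k \<in> {k. k < n \<and> b k = b i}" unfolding k_def using assms by (intro Max_in[OF fin]) auto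
  moreover have "b (Suc k) \<noteq> b k" if "Suc k < n"
    using Max_ge[OF fin, of "Suc k"] that calculation by (auto simp: k_def[symmetric])
  ultimately show ?thesis by (intro that[of k]) auto
qed

text \<open>\<open>U\<close> is supported on indices whose unit vectors are eigenvectors for
  \<open>e\<close>, so it is a combination of eigenvectors.\<close>

lemma eigen_column:
  fixes A :: "'a::field mat"
  assumes A: "A \<in> carrier_mat n n" and U: "U \<in> carrier_mat n 1"
    and cols: "\<And>k r. k < n \<Longrightarrow> r < n \<Longrightarrow> U $$ (k, 0) \<noteq> 0 \<Longrightarrow>
      A $$ (r, k) = (if r = k then e else 0)"
  shows "A * U = e \<cdot>\<^sub>m U"
proof (rule eq_matI)
  fix r c assume "r < dim_row (e \<cdot>\<^sub>m U)" "c < dim_col (e \<cdot>\<^sub>m U)"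
  then have r: "r < n" and c: "c = 0" using U by auto
  have "(A * U) $$ (r, c) = (\<Sum>k<n. A $$ (r, k) * U $$ (k, 0))"
    using A U r c by (simp add: scalar_prod_def atLeast0LessThan)
  also have "\<dots> = (\<Sum>k<n. if k = r then e * U $$ (k, 0) else 0)"
  proof (rule sum.cong)
    fix k assume "k \<in> {..<n}"
    then show "A $$ (r, k) * U $$ (k, 0) = (if k = r then e * U $$ (k, 0) else 0)"
      using cols[of k r] r by (cases "U $$ (k, 0) = 0") auto
  qed simp
  finally show "(A * U) $$ (r, c) = (e \<cdot>\<^sub>m U) $$ (r, c)" using U r c by simp
qed (use A U in auto)

lemma eigen_row:
  fixes A :: "'a::field mat"
  assumes A: "A \<in> carrier_mat n n" and W: "W \<in> carrier_mat 1 n"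
    and rows: "\<And>k r. k < n \<Longrightarrow> r < n \<Longrightarrow> W $$ (0, k) \<noteq> 0 \<Longrightarrow>
      A $$ (k, r) = (if r = k then e else 0)"
  shows "W * A = e \<cdot>\<^sub>m W"
proof -
  have "transpose_mat A * transpose_mat W = e \<cdot>\<^sub>m transpose_mat W"
    using A W rows by (intro eigen_column[of _ n]) auto
  moreover have "transpose_mat (e \<cdot>\<^sub>m W) = e \<cdot>\<^sub>m transpose_mat W" by (intro eq_matI) auto
  ultimately have "transpose_mat (W * A) = transpose_mat (e \<cdot>\<^sub>m W)"
    using transpose_mult[OF W A] by simp
  then show ?thesis by (simp only: transpose_mat_eq)
qed

definition rank_one_commuting :: "nat \<Rightarrow> 'a::field mat \<Rightarrow> 'a mat \<Rightarrow> 'a mat \<Rightarrow> bool" where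
  "rank_one_commuting n A U W \<longleftrightarrow> U \<in> carrier_mat n 1 \<and> U \<noteq> 0\<^sub>m n 1 \<and>
     W \<in> carrier_mat 1 n \<and> W \<noteq> 0\<^sub>m 1 n \<and> U * W \<in> centralizer n A"

lemma (in mat_conj) rank_one_commuting_cj:
  assumes "rank_one_commuting n A U W" and A: "A \<in> carrier_mat n n"
  shows "rank_one_commuting n (cj A) (P * U) (W * Q)"
proof -
  have U: "U \<in> carrier_mat n 1" "U \<noteq> 0\<^sub>m n 1" and W: "W \<in> carrier_mat 1 n" "W \<noteq> 0\<^sub>m 1 n"
    and c: "U * W \<in> centralizer n A"
    using assms by (auto simp: rank_one_commuting_def)
  have "Q * (P * U) = Q * P * U" using P Q U by (intro assoc_mult_mat[symmetric]) auto
  then have "P * U \<noteq> 0\<^sub>m n 1" using U Q by (auto simp: QP)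
  moreover have "W * Q * P = W" using P Q W by (simp add: assoc_mult_mat[of _ 1 n _ n _ n] QP)
  then have "W * Q \<noteq> 0\<^sub>m 1 n" using W P by auto
  moreover have "cj (U * W) = (P * U) * (W * Q)"
  proof -
    have "P * (U * W) = P * U * W" using P U W by (intro assoc_mult_mat[symmetric]) auto
    moreover have "P * U * W * Q = (P * U) * (W * Q)" using P Q U W by (intro assoc_mult_mat) auto
    ultimately show ?thesis by (simp only: cj_def)
  qed
  ultimately show ?thesis
    using P Q U W cj_centralizer[OF A c] by (simp add: rank_one_commuting_def)
qed

text \<open>In Jordan form, the first and the last unit vector of the block at position 0 are a
  right and a left eigenvector for the same eigenvalue.\<close>

lemma exists_rank_one_commuting:
  fixes A :: "'a::alg_closed_field mat"
  assumes A: "A \<in> carrier_mat n n" and n: "0 < n"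
  obtains U W where "rank_one_commuting n A U W"
proof -
  obtain b f where sim: "similar_mat A (jordan_mat n b f)" and "mono b"
    using exists_similar_jordan_mat[OF A] by blast
  let ?J = "jordan_mat n b f"
  obtain k where k: "k < n" "b k = b 0" "\<And>r. Suc r = k \<Longrightarrow> b r \<noteq> b k"
    using obtain_first_of_block[OF n] by blast
  obtain l where l: "l < n" "b l = b 0" "Suc l < n \<Longrightarrow> b (Suc l) \<noteq> b l"
    using obtain_last_of_block[OF n] by blast
  define U where "U = mat n 1 (\<lambda>(r, _). if r = k then 1 else 0 :: 'a)"
  define W where "W = mat 1 n (\<lambda>(_, r). if r = l then 1 else 0 :: 'a)"
  have U: "U \<in> carrier_mat n 1" and W: "W \<in> carrier_mat 1 n" by (auto simp: U_def W_def)
  have "U $$ (k, 0) \<noteq> 0" "W $$ (0, l) \<noteq> 0" using k l by (auto simp: U_def W_def)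
  then have "U \<noteq> 0\<^sub>m n 1" "W \<noteq> 0\<^sub>m 1 n" using k l by auto
  moreover have "?J * U = f (b 0) \<cdot>\<^sub>m U"
  proof (rule eigen_column[OF _ U])
    fix i r assume "i < n" "r < n" "U $$ (i, 0) \<noteq> 0"
    moreover from this have "i = k" by (auto simp: U_def split: if_splits)
    ultimately show "?J $$ (r, i) = (if r = i then f (b 0) else 0)"
      using jordan_mat_first_column[of k n b r f] k by auto
  qed simp
  moreover have "W * ?J = f (b 0) \<cdot>\<^sub>m W"
  proof (rule eigen_row[OF _ W])
    fix i r assume "i < n" "r < n" "W $$ (0, i) \<noteq> 0"
    moreover from this have "i = l" by (auto simp: W_def split: if_splits)
    ultimately show "?J $$ (i, r) = (if r = i then f (b 0) else 0)"
      using jordan_mat_last_row[of l n b r f] l by auto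
  qed simp
  ultimately have "rank_one_commuting n ?J U W"
    using U W outer_centralizer[of ?J n U W "f (b 0)"] by (auto simp: rank_one_commuting_def)
  moreover obtain P Q where PQ: "mat_conj n P Q" "A = mat_conj.cj P Q ?J"
    using similar_mat_conj[OF sim A] by blast
  ultimately show ?thesis
    using mat_conj.rank_one_commuting_cj[OF PQ(1)] that by fastforce
qed

section \<open>Derogatory matrices and the diameter bound\<close>

lemma sum_two_points:
  fixes g :: "nat \<Rightarrow> 'a::comm_monoid_add"
  assumes "k < n" "l < n" "k \<noteq> l" "\<And>r. r < n \<Longrightarrow> r \<noteq> k \<Longrightarrow> r \<noteq> l \<Longrightarrow> g r = 0"
  shows "(\<Sum>r<n. g r) = g k + g l"
proof -
  have "(\<Sum>r<n. g r) = (\<Sum>r\<in>{k, l}. g r)"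
    using assms by (intro sum.mono_neutral_right) auto
  then show ?thesis using assms(3) by simp
qed

text \<open>The first unit vectors of two blocks with equal eigenvalues span a plane of
  eigenvectors, on which \<open>R\<close> imposes a single linear condition.\<close>

lemma jordan_mat_eigen_column_orthogonal:
  assumes i: "i < n" "j < n" "b i \<noteq> b j" "f (b i) = f (b j)"
    and R: "R \<in> carrier_mat 1 n"
  obtains U where "U \<in> carrier_mat n 1" "U \<noteq> 0\<^sub>m n 1"
    "jordan_mat n b f * U = f (b i) \<cdot>\<^sub>m U" "R * U = 0\<^sub>m 1 1"
proof -
  obtain k where k: "k < n" "b k = b i" "\<And>r. Suc r = k \<Longrightarrow> b r \<noteq> b k"
    using obtain_first_of_block[OF i(1)] by blast
  obtain l where l: "l < n" "b l = b j" "\<And>r. Suc r = l \<Longrightarrow> b r \<noteq> b l"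
    using obtain_first_of_block[OF i(2)] by blast
  have kl: "k \<noteq> l" using k l i by auto
  obtain x y where xy: "x \<noteq> 0 \<or> y \<noteq> 0" "R $$ (0, k) * x + R $$ (0, l) * y = 0"
  proof (cases "R $$ (0, k) = 0")
    case True
    then show ?thesis by (intro that[of 1 0]) auto
  next
    case False
    then show ?thesis by (intro that[of "- R $$ (0, l)" "R $$ (0, k)"]) auto
  qed
  define U where "U = mat n 1 (\<lambda>(r, _). if r = k then x else if r = l then y else 0)"
  have U: "U \<in> carrier_mat n 1" by (simp add: U_def)
  have vals: "U $$ (k, 0) = x" "U $$ (l, 0) = y" using k l kl by (auto simp: U_def)
  have "U \<noteq> 0\<^sub>m n 1" using xy vals k l by auto
  moreover have "jordan_mat n b f * U = f (b i) \<cdot>\<^sub>m U"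
  proof (rule eigen_column[OF _ U])
    fix s r assume "s < n" "r < n" "U $$ (s, 0) \<noteq> 0"
    moreover from this have "s = k \<or> s = l" by (auto simp: U_def split: if_splits)
    ultimately show "jordan_mat n b f $$ (r, s) = (if r = s then f (b i) else 0)"
      using jordan_mat_first_column[of k n b r f] jordan_mat_first_column[of l n b r f] k l i by auto
  qed simp
  moreover have "R * U = 0\<^sub>m 1 1"
  proof (rule eq_matI)
    fix r c assume "r < dim_row (0\<^sub>m 1 1 :: 'a mat)" "c < dim_col (0\<^sub>m 1 1 :: 'a mat)"
    then have rc: "r = 0" "c = 0" by auto
    have "(R * U) $$ (0, 0) = (\<Sum>r<n. R $$ (0, r) * U $$ (r, 0))"
      using R U by (simp add: scalar_prod_def atLeast0LessThan)
    also have "\<dots> = R $$ (0, k) * U $$ (k, 0) + R $$ (0, l) * U $$ (l, 0)"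
      by (rule sum_two_points) (use k l kl in \<open>auto simp: U_def\<close>)
    finally show "(R * U) $$ (r, c) = 0\<^sub>m 1 1 $$ (r, c)" using rc vals xy by simp
  qed (use R U in auto)
  ultimately show ?thesis using U by (intro that)
qed

lemma jordan_mat_eigen_row_orthogonal:
  assumes i: "i < n" "j < n" "b i \<noteq> b j" "f (b i) = f (b j)"
    and X: "X \<in> carrier_mat n 1"
  obtains W where "W \<in> carrier_mat 1 n" "W \<noteq> 0\<^sub>m 1 n"
    "W * jordan_mat n b f = f (b i) \<cdot>\<^sub>m W" "W * X = 0\<^sub>m 1 1"
proof -
  obtain k where k: "k < n" "b k = b i" "Suc k < n \<Longrightarrow> b (Suc k) \<noteq> b k"
    using obtain_last_of_block[OF i(1)] by blast
  obtain l where l: "l < n" "b l = b j" "Suc l < n \<Longrightarrow> b (Suc l) \<noteq> b l"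
    using obtain_last_of_block[OF i(2)] by blast
  have kl: "k \<noteq> l" using k l i by auto
  obtain x y where xy: "x \<noteq> 0 \<or> y \<noteq> 0" "x * X $$ (k, 0) + y * X $$ (l, 0) = 0"
  proof (cases "X $$ (k, 0) = 0")
    case True
    then show ?thesis by (intro that[of 1 0]) auto
  next
    case False
    then show ?thesis by (intro that[of "- X $$ (l, 0)" "X $$ (k, 0)"]) auto
  qed
  define W where "W = mat 1 n (\<lambda>(_, r). if r = k then x else if r = l then y else 0)"
  have W: "W \<in> carrier_mat 1 n" by (simp add: W_def)
  have vals: "W $$ (0, k) = x" "W $$ (0, l) = y" using k l kl by (auto simp: W_def)
  have "W \<noteq> 0\<^sub>m 1 n" using xy vals k l by auto
  moreover have "W * jordan_mat n b f = f (b i) \<cdot>\<^sub>m W"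
  proof (rule eigen_row[OF _ W])
    fix s r assume "s < n" "r < n" "W $$ (0, s) \<noteq> 0"
    moreover from this have "s = k \<or> s = l" by (auto simp: W_def split: if_splits)
    ultimately show "jordan_mat n b f $$ (s, r) = (if r = s then f (b i) else 0)"
      using jordan_mat_last_row[of k n b r f] jordan_mat_last_row[of l n b r f] k l i by auto
  qed simp
  moreover have "W * X = 0\<^sub>m 1 1"
  proof (rule eq_matI)
    fix r c assume "r < dim_row (0\<^sub>m 1 1 :: 'a mat)" "c < dim_col (0\<^sub>m 1 1 :: 'a mat)"
    then have rc: "r = 0" "c = 0" by auto
    have "(W * X) $$ (0, 0) = (\<Sum>r<n. W $$ (0, r) * X $$ (r, 0))"
      using W X by (simp add: scalar_prod_def atLeast0LessThan)
    also have "\<dots> = W $$ (0, k) * X $$ (k, 0) + W $$ (0, l) * X $$ (l, 0)"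
      by (rule sum_two_points) (use k l kl in \<open>auto simp: W_def\<close>)
    finally show "(W * X) $$ (r, c) = 0\<^sub>m 1 1 $$ (r, c)" using rc vals xy by simp
  qed (use W X in auto)
  ultimately show ?thesis using W by (intro that)
qed

text \<open>Given \<open>V * R\<close> commuting with \<open>X\<close>, choose an eigenvector
  \<open>U\<close> killed by \<open>R\<close> and a left eigenvector \<open>W\<close> that kills
  \<open>V\<close>. Then \<open>U * W\<close> and \<open>V * R\<close> annihilate each
  other.\<close>

lemma derogatory_linked:
  fixes X :: "'a::alg_closed_field mat"
  assumes i: "i < n" "j < n" "b i \<noteq> b j" "f (b i) = f (b j)" and X: "X \<in> carrier_mat n n"
  shows "linked n (jordan_mat n b f) X"
proof -
  let ?J = "jordan_mat n b f"
  have n: "2 \<le> n" using i by (cases "n = 1") auto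
  obtain V R where VR: "rank_one_commuting n X V R"
    using exists_rank_one_commuting[OF X] n by auto
  then have V: "V \<in> carrier_mat n 1" "V \<noteq> 0\<^sub>m n 1" and R: "R \<in> carrier_mat 1 n" "R \<noteq> 0\<^sub>m 1 n"
    and c: "V * R \<in> centralizer n X" by (auto simp: rank_one_commuting_def)
  obtain U where U: "U \<in> carrier_mat n 1" "U \<noteq> 0\<^sub>m n 1" "?J * U = f (b i) \<cdot>\<^sub>m U" "R * U = 0\<^sub>m 1 1"
    using jordan_mat_eigen_column_orthogonal[OF i R(1)] by blast
  obtain W where W: "W \<in> carrier_mat 1 n" "W \<noteq> 0\<^sub>m 1 n" "W * ?J = f (b i) \<cdot>\<^sub>m W" "W * V = 0\<^sub>m 1 1"
    using jordan_mat_eigen_row_orthogonal[OF i V(1)] by blast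
  have "(U * W) * (V * R) = (V * R) * (U * W)"
    using outer_mult_outer_eq_0[OF U(1) W(1) V(1) R(1) W(4)]
      outer_mult_outer_eq_0[OF V(1) R(1) U(1) W(1) U(4)] by simp
  moreover have "U * W \<in> centralizer n ?J"
    by (rule outer_centralizer[OF _ U(1) W(1) U(3) W(3)]) simp
  moreover have "U * W \<in> nonscalar n" "V * R \<in> nonscalar n"
    using outer_nonscalar U V W R n by blast+
  ultimately show ?thesis using c unfolding linked_def by blast
qed

text \<open>The walk is A, \<open>U * W\<close>, \<open>S * T\<close>, \<open>V * R\<close>, X,
  where the middle matrix annihilates both of its neighbours from either side.\<close>

lemma walk_le_4:
  fixes A X :: "'a::alg_closed_field mat"
  assumes n: "3 \<le> n" and A: "A \<in> nonscalar n" and X: "X \<in> nonscalar n"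
  shows "walk_le n 4 A X"
proof -
  have n0: "0 < n" "2 \<le> n" using n by auto
  obtain U W where "rank_one_commuting n A U W"
    using exists_rank_one_commuting[OF nonscalarD[OF A] n0(1)] .
  then have U: "U \<in> carrier_mat n 1" "U \<noteq> 0\<^sub>m n 1" and W: "W \<in> carrier_mat 1 n" "W \<noteq> 0\<^sub>m 1 n"
    and UW: "U * W \<in> centralizer n A" by (auto simp: rank_one_commuting_def)
  obtain V R where "rank_one_commuting n X V R"
    using exists_rank_one_commuting[OF nonscalarD[OF X] n0(1)] .
  then have V: "V \<in> carrier_mat n 1" "V \<noteq> 0\<^sub>m n 1" and R: "R \<in> carrier_mat 1 n" "R \<noteq> 0\<^sub>m 1 n"
    and VR: "V * R \<in> centralizer n X" by (auto simp: rank_one_commuting_def)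
  obtain S where S: "S \<in> carrier_mat n 1" "S \<noteq> 0\<^sub>m n 1" "W * S = 0\<^sub>m 1 1" "R * S = 0\<^sub>m 1 1"
    using exists_orthogonal_column[OF n W(1) R(1)] by blast
  obtain T where T: "T \<in> carrier_mat 1 n" "T \<noteq> 0\<^sub>m 1 n" "T * U = 0\<^sub>m 1 1" "T * V = 0\<^sub>m 1 1"
    using exists_orthogonal_row[OF n U(1) V(1)] by blast
  have ns: "U * W \<in> nonscalar n" "S * T \<in> nonscalar n" "V * R \<in> nonscalar n"
    using outer_nonscalar U V W R S T n0 by blast+
  have "A * (U * W) = (U * W) * A" "(V * R) * X = X * (V * R)"
    using centralizerD(2)[OF UW] centralizerD(2)[OF VR] by simp_all
  moreover have "(U * W) * (S * T) = (S * T) * (U * W)"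
    using outer_mult_outer_eq_0[OF U(1) W(1) S(1) T(1) S(3)]
      outer_mult_outer_eq_0[OF S(1) T(1) U(1) W(1) T(3)] by simp
  moreover have "(S * T) * (V * R) = (V * R) * (S * T)"
    using outer_mult_outer_eq_0[OF V(1) R(1) S(1) T(1) S(4)]
      outer_mult_outer_eq_0[OF S(1) T(1) V(1) R(1) T(4)] by simp
  ultimately have "walk_le n (Suc (Suc (Suc (Suc 0)))) A X"
    using A X ns unfolding walk_le_Suc walk_le_0 by blast
  then show ?thesis by (simp add: numeral_eq_Suc)
qed

section \<open>Nonderogatory Jordan matrices are similar to companion matrices\<close>

lemma linear_power_dvd_if_shifted_coeffs:
  fixes q :: "'a::field poly"
  assumes "\<And>j. j < m \<Longrightarrow> coeff (pcompose q [:e, 1:]) j = 0"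
  shows "[:- e, 1:] ^ m dvd q"
proof -
  have "monom 1 m dvd pcompose q [:e, 1:]" using assms by (simp add: monom_1_dvd_iff')
  then obtain r where r: "pcompose q [:e, 1:] = [:0, 1:] ^ m * r"
    by (auto simp: monom_altdef dvd_def)
  have "q = pcompose (pcompose q [:e, 1:]) [:- e, 1:]"
    by (simp add: pcompose_pCons flip: pcompose_assoc)
  also have "\<dots> = [:- e, 1:] ^ m * pcompose r [:- e, 1:]"
    by (simp add: r pcompose_mult pcompose_hom.hom_power pcompose_pCons)
  finally show ?thesis by (metis dvd_triv_left)
qed

lemma poly_eq_0_if_many_roots:
  fixes q :: "'a::field poly"
  assumes S: "finite S" and roots: "\<And>e. e \<in> S \<Longrightarrow> [:- e, 1:] ^ m e dvd q"
    and deg: "degree q < (\<Sum>e\<in>S. m e)"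
  shows "q = 0"
proof (rule ccontr)
  assume q: "q \<noteq> 0"
  have ord: "m e \<le> order e q" if "e \<in> S" for e using roots[OF that] q by (simp add: order_divides)
  have "(\<Sum>e\<in>S. m e) \<le> (\<Sum>e\<in>S. order e q)" using ord by (rule sum_mono)
  also have "\<dots> = (\<Sum>e\<in>S \<inter> {x. poly q x = 0}. order e q)"
    using S by (intro sum.mono_neutral_right) (auto simp: order_root)
  also have "\<dots> \<le> (\<Sum>e | poly q e = 0. order e q)"
    using q by (intro sum_mono2) (auto simp: poly_roots_finite)
  also have "\<dots> \<le> degree q" using q by (rule sum_order_le_degree)
  finally show False using deg by simp
qed

definition block_pos :: "nat \<Rightarrow> (nat \<Rightarrow> nat) \<Rightarrow> nat \<Rightarrow> nat" where
  "block_pos n b i = card {k. i < k \<and> k < n \<and> b k = b i}"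

lemma block_pos_image:
  "block_pos n b ` {i. i < n \<and> b i = p} = {..<card {i. i < n \<and> b i = p}}"
proof -
  let ?B = "{i. i < n \<and> b i = p}"
  have less: "block_pos n b j < block_pos n b i" if "i \<in> ?B" "j \<in> ?B" "i < j" for i j
    unfolding block_pos_def using that by (intro psubset_card_mono) auto
  have inj: "inj_on (block_pos n b) ?B"
  proof (rule inj_onI)
    fix i j assume "i \<in> ?B" "j \<in> ?B" "block_pos n b i = block_pos n b j"
    then show "i = j" using less[of i j] less[of j i] by (cases i j rule: linorder_cases) auto
  qed
  have "block_pos n b i < card ?B" if "i \<in> ?B" for i
    unfolding block_pos_def using that by (intro psubset_card_mono) auto
  then have "block_pos n b ` ?B \<subseteq> {..<card ?B}" by auto
  then show ?thesis by (intro card_subset_eq) (auto simp: card_image[OF inj])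
qed

lemma block_pos_step:
  assumes "Suc i < n" "b (Suc i) = b i"
  shows "block_pos n b i = Suc (block_pos n b (Suc i))"
proof -
  have "{k. i < k \<and> k < n \<and> b k = b i} = insert (Suc i) {k. Suc i < k \<and> k < n \<and> b k = b (Suc i)}"
    using assms by (auto simp: Suc_lessI)
  then show ?thesis by (simp add: block_pos_def)
qed

lemma block_pos_last:
  assumes "mono b" "Suc i < n \<Longrightarrow> b (Suc i) \<noteq> b i"
  shows "block_pos n b i = 0"
proof -
  have "b k \<noteq> b i" if "i < k" "k < n" for k
  proof -
    have "b i \<le> b (Suc i)" "b (Suc i) \<le> b k" using assms(1) that by (auto intro: monoD)
    then show ?thesis using assms(2) that by linarith
  qed
  then have empty: "{k. i < k \<and> k < n \<and> b k = b i} = {}" by blast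
  show ?thesis unfolding block_pos_def empty by simp
qed

text \<open>Evaluating \<open>q\<close> at a Jordan block with eigenvalue \<open>e\<close> and applying it to the last unit vector
  yields the Taylor coefficients of \<open>q\<close> at \<open>e\<close>. Hence column \<open>i\<close> below is \<open>J^i v\<close>, where \<open>v\<close> is the
  sum of the last unit vectors of all blocks.\<close>

definition krylov_mat :: "nat \<Rightarrow> (nat \<Rightarrow> nat) \<Rightarrow> (nat \<Rightarrow> 'a::field) \<Rightarrow> 'a mat" where
  "krylov_mat n b f = mat n n (\<lambda>(r, i). coeff ([:f (b r), 1:] ^ i) (block_pos n b r))"

lemma jordan_mat_mult_krylov_mat:
  assumes b: "mono b" and r: "r < n" and i: "Suc i < n"
  shows "(jordan_mat n b f * krylov_mat n b f) $$ (r, i) = krylov_mat n b f $$ (r, Suc i)"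
proof -
  let ?P = "krylov_mat n b f"
  have "(jordan_mat n b f * ?P) $$ (r, i) =
      f (b r) * ?P $$ (r, i) + (if Suc r < n \<and> b (Suc r) = b r then ?P $$ (Suc r, i) else 0)"
    using r i by (intro jordan_mat_mult_index) (auto simp: krylov_mat_def)
  also have "\<dots> = ?P $$ (r, Suc i)"
  proof (cases "Suc r < n \<and> b (Suc r) = b r")
    case True
    then show ?thesis using r i block_pos_step[of r n b] by (simp add: krylov_mat_def)
  next
    case False
    then have "block_pos n b r = 0" using block_pos_last[OF b] by blast
    then show ?thesis
      using r i by (simp only: if_not_P[OF False]) (simp add: krylov_mat_def)
  qed
  finally show ?thesis .
qed

lemma krylov_mat_trivial_kernel:
  fixes f :: "nat \<Rightarrow> 'a::field"
  assumes inj: "inj_on f (b ` {..<n})"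
    and x: "x \<in> carrier_vec n" "krylov_mat n b f *\<^sub>v x = 0\<^sub>v n"
  shows "x = 0\<^sub>v n"
proof (cases "n = 0")
  case True
  then show ?thesis using x by auto
next
  case False
  define q where "q = (\<Sum>i<n. monom (x $ i) i)"
  have coeff_q: "coeff q i = (if i < n then x $ i else 0)" for i
    by (simp add: q_def coeff_sum coeff_monom)
  have deg: "degree q < n"
    using False degree_lessI[of q n] coeff_q by (auto simp: coeff_eq_0)
  have "coeff (pcompose q [:f (b r), 1:]) (block_pos n b r) = 0" if "r < n" for r
  proof -
    have "coeff (pcompose q [:f (b r), 1:]) (block_pos n b r) =
        (\<Sum>i<n. x $ i * coeff ([:f (b r), 1:] ^ i) (block_pos n b r))"
      by (simp add: q_def pcompose_sum coeff_sum monom_altdef pcompose_smult pcompose_hom.hom_power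
          pcompose_pCons)
    also have "\<dots> = (krylov_mat n b f *\<^sub>v x) $ r"
      using that x(1)
      by (auto simp: krylov_mat_def scalar_prod_def atLeast0LessThan mult.commute intro!: sum.cong)
    also have "\<dots> = 0" using x(2) that by simp
    finally show ?thesis .
  qed
  note coeffs = this
  let ?m = "\<lambda>p. card {i. i < n \<and> b i = p}"
  have dvd: "[:- f p, 1:] ^ ?m p dvd q" for p
  proof (rule linear_power_dvd_if_shifted_coeffs)
    fix j assume "j < ?m p"
    then have "j \<in> block_pos n b ` {i. i < n \<and> b i = p}" by (simp add: block_pos_image)
    then show "coeff (pcompose q [:f p, 1:]) j = 0" using coeffs by auto
  qed
  define S where "S = f ` b ` {..<n}"
  define m where "m e = ?m (the_inv_into (b ` {..<n}) f e)" for e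
  have m: "m (f p) = ?m p" if "p \<in> b ` {..<n}" for p
    using the_inv_into_f_f[OF inj that] by (simp add: m_def)
  have "q = 0"
  proof (rule poly_eq_0_if_many_roots)
    show "finite S" by (simp add: S_def)
    show "[:- e, 1:] ^ m e dvd q" if "e \<in> S" for e using that dvd m by (auto simp: S_def)
    have "(\<Sum>e\<in>S. m e) = (\<Sum>p\<in>b ` {..<n}. ?m p)"
      unfolding S_def using m by (subst sum.reindex[OF inj]) (auto intro: sum.cong)
    also have "\<dots> = card {..<n}"
      using sum.image_gen[of "{..<n}" "\<lambda>_. 1::nat" b] by (simp add: conj_commute)
    finally show "degree q < (\<Sum>e\<in>S. m e)" using deg by simp
  qed
  then have "x $ i = 0" if "i < n" for i using coeff_q[of i] that by simp
  then show ?thesis using x(1) by (intro eq_vecI) auto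
qed

lemma jordan_mat_similar_companion:
  fixes f :: "nat \<Rightarrow> 'a::field"
  assumes b: "mono b" and inj: "inj_on f (b ` {..<n})"
  obtains P Q C where "mat_conj n P Q" "companion n C" "jordan_mat n b f = mat_conj.cj P Q C"
proof -
  let ?J = "jordan_mat n b f" and ?P = "krylov_mat n b f"
  have P: "?P \<in> carrier_mat n n" by (simp add: krylov_mat_def)
  obtain Q where conj: "mat_conj n ?P Q"
    using mat_conj_if_trivial_kernel[OF P] krylov_mat_trivial_kernel[OF inj] by blast
  interpret mat_conj n ?P Q by fact
  interpret sw: mat_conj n Q ?P by (rule swap)
  let ?C = "sw.cj ?J"
  have C: "?C \<in> carrier_mat n n" by (simp add: sw.cj_carrier)
  have entry: "?C $$ (i, j) = (if i = Suc j then 1 else 0)" if "i < n" "Suc j < n" for i j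
  proof -
    have "?C $$ (i, j) = (Q * (?J * ?P)) $$ (i, j)"
      using P Q by (simp add: sw.cj_def assoc_mult_mat[of _ n n _ n _ n])
    also have "\<dots> = (\<Sum>k<n. Q $$ (i, k) * (?J * ?P) $$ (k, j))"
      using mult_carrier_mat[OF jordan_mat_carrier P] Q that by (intro index_mult_mat_sum) auto
    also have "\<dots> = (\<Sum>k<n. Q $$ (i, k) * ?P $$ (k, Suc j))"
      using that by (intro sum.cong) (auto simp: jordan_mat_mult_krylov_mat[OF b])
    also have "\<dots> = (Q * ?P) $$ (i, Suc j)"
      using P Q that by (intro index_mult_mat_sum[symmetric]) auto
    finally show ?thesis using that by (simp add: QP)
  qed
  have "companion n ?C" using C entry by (auto simp: companion_def)
  then show ?thesis using that[OF conj] sw.cj_cancel[of ?J] by simp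
qed

lemma nonderogatory_jordan_mat:
  fixes f :: "nat \<Rightarrow> 'a::field"
  assumes b: "mono b" and inj: "inj_on f (b ` {..<n})" and n: "2 \<le> n"
  shows "far n (jordan_mat n b f)" "commutative_centralizer n (jordan_mat n b f)"
proof -
  obtain P Q C where conj: "mat_conj n P Q" and C: "companion n C"
    and J: "jordan_mat n b f = mat_conj.cj P Q C"
    using jordan_mat_similar_companion[OF b inj] .
  interpret mat_conj n P Q by fact
  have carrier: "C \<in> carrier_mat n n" using C by (simp add: companion_def)
  have "far n C"
    using companion_not_linked_shift_mat[OF C] shift_mat_nonscalar[OF n] by (auto simp: far_def)
  then show "far n (jordan_mat n b f)" unfolding J using carrier by (rule far_cj)
  have "commutative_centralizer n C"
    using companion_centralizer_commutative[OF C] by (auto simp: commutative_centralizer_def)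
  then show "commutative_centralizer n (jordan_mat n b f)"
    unfolding J using carrier by (rule commutative_centralizer_cj)
qed

section \<open>Minimal matrices\<close>

lemma infinite_UNIV_alg_closed: "infinite (UNIV :: 'a::alg_closed_field set)"
proof
  assume fin: "finite (UNIV :: 'a set)"
  define p :: "'a poly" where "p = (\<Prod>a\<in>UNIV. [:- a, 1:]) + 1"
  have "degree (\<Prod>a\<in>(UNIV :: 'a set). [:- a, 1:]) = (\<Sum>a\<in>(UNIV :: 'a set). 1)"
    by (subst degree_prod_eq_sum_degree) auto
  then have "degree (\<Prod>a\<in>(UNIV :: 'a set). [:- a, 1:]) > 0" using fin by (simp add: finite_UNIV_card_ge_0)
  then have "degree p > 0" by (simp add: p_def degree_add_eq_left)
  then obtain x where "poly p x = 0" using alg_closed_imp_poly_has_root by blast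
  moreover have "poly (\<Prod>a\<in>UNIV. [:- a, 1:]) x = 0"
    using fin by (auto simp: poly_prod intro!: prod_zero bexI[of _ x])
  ultimately show False by (simp add: p_def)
qed

lemma minimal_mat_if_commutative_centralizer:
  assumes "commutative_centralizer n A"
  shows "minimal_mat n A"
  unfolding minimal_mat_def
proof (intro ballI impI)
  fix X assume X: "X \<in> carrier_mat n n" and sub: "centralizer n X \<subseteq> centralizer n A"
  have "X \<in> centralizer n A" using sub centralizerI[OF X refl] by blast
  then have "centralizer n A \<subseteq> centralizer n X"
    using assms unfolding commutative_centralizer_def
    by (intro subsetI centralizerI) (blast dest: centralizerD(1))+
  with sub show "centralizer n X = centralizer n A" by blast
qed

lemma minimal_mat_far:
  fixes A :: "'a::alg_closed_field mat"
  assumes n: "2 \<le> n" and A: "A \<in> carrier_mat n n" and min: "minimal_mat n A"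
  shows "far n A"
proof -
  obtain b f where b: "mono b" and sim: "similar_mat A (jordan_mat n b f)"
    using exists_similar_jordan_mat[OF A] .
  obtain P Q where conj: "mat_conj n P Q" and A_eq: "A = mat_conj.cj P Q (jordan_mat n b f)"
    using similar_mat_conj[OF sim A] .
  interpret mat_conj n P Q by fact
  obtain g :: "nat \<Rightarrow> 'a" where "inj g"
    using infinite_UNIV_alg_closed infinite_countable_subset by blast
  then have inj: "inj_on g (b ` {..<n})" by (rule inj_on_subset) simp
  define B where "B = cj (jordan_mat n b g)"
  note nonder = nonderogatory_jordan_mat[OF b inj n]
  have B: "B \<in> carrier_mat n n" by (simp add: B_def cj_carrier)
  have far: "far n B" and comm: "commutative_centralizer n B"
    unfolding B_def by (rule far_cj[OF nonder(1)] commutative_centralizer_cj[OF nonder(2)], simp)+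
  have "A \<in> centralizer n B"
    unfolding A_eq B_def
    by (intro cj_centralizer centralizerI jordan_mat_carrier jordan_mat_commute)
  then have "centralizer n B \<subseteq> centralizer n A"
    using comm unfolding commutative_centralizer_def
    by (intro subsetI centralizerI) (blast dest: centralizerD(1))+
  then have "centralizer n B = centralizer n A"
    using min B by (auto simp: minimal_mat_def)
  then show ?thesis using far by (simp add: far_def linked_def)
qed

lemma commutative_centralizer_if_not_linked:
  fixes A :: "'a::alg_closed_field mat"
  assumes n: "2 \<le> n" and A: "A \<in> carrier_mat n n" and X: "X \<in> carrier_mat n n"
    and not_linked: "\<not> linked n A X"
  shows "commutative_centralizer n A"
proof -
  obtain b f where b: "mono b" and sim: "similar_mat A (jordan_mat n b f)"
    using exists_similar_jordan_mat[OF A] .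
  obtain P Q where conj: "mat_conj n P Q" and A_eq: "A = mat_conj.cj P Q (jordan_mat n b f)"
    using similar_mat_conj[OF sim A] .
  interpret mat_conj n P Q by fact
  interpret sw: mat_conj n Q P by (rule swap)
  have "inj_on f (b ` {..<n})"
  proof (rule ccontr)
    assume "\<not> ?thesis"
    then obtain i j where ij: "i < n" "j < n" "b i \<noteq> b j" "f (b i) = f (b j)"
      by (auto simp: inj_on_def)
    have "linked n (jordan_mat n b f) (sw.cj X)"
      by (rule derogatory_linked[where f = f, OF ij sw.cj_carrier[OF X]])
    then have "linked n A X"
      using linked_cj[of "jordan_mat n b f" "sw.cj X"] X
      by (simp add: A_eq sw.cj_carrier sw.cj_cancel)
    then show False using not_linked by simp
  qed
  from nonderogatory_jordan_mat(2)[OF b this n] show ?thesis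
    unfolding A_eq by (rule commutative_centralizer_cj) simp
qed

theorem theorem2p10:
  fixes A :: "'a::alg_closed_field mat" and n :: nat
  assumes "n \<ge> 3"
    and "A \<in> carrier_mat n n"
    and "\<not> scalar_mat n A"
  shows "minimal_mat n A \<longleftrightarrow>
    (\<exists>X. X \<in> carrier_mat n n \<and> \<not> scalar_mat n X \<and>
         graph_dist (with_proj (commuting_graph n)) A X = 4)"
proof -
  have n: "2 \<le> n" and A: "A \<in> nonscalar n" using assms by (auto simp: nonscalar_def)
  have "(\<exists>X. X \<in> carrier_mat n n \<and> \<not> scalar_mat n X \<and>
      graph_dist (with_proj (commuting_graph n)) A X = 4) \<longleftrightarrow> far n A"
    using graph_dist_eq_4_iff[OF A] walk_le_4[OF assms(1) A]
    unfolding far_def nonscalar_def by blast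
  moreover have "far n A \<Longrightarrow> minimal_mat n A"
    using commutative_centralizer_if_not_linked[OF n assms(2)]
    unfolding far_def by (blast intro: minimal_mat_if_commutative_centralizer nonscalarD)
  ultimately show ?thesis using minimal_mat_far[OF n assms(2)] by blast
qed

end
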